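(* Let $F$ be a field of characteristic $0$ and let $\mathfrak{g}$ be a Lie algebra over $F$. Rota-Baxter operators of weight $1$ on the Lie algebra $\mathfrak{g}$ are in one to one correspondence with Rota-Baxter operators on the universal enveloping algebra $U(\mathfrak{g})$ (regarded as a cocommutative Hopf algebra).
   Context: A Rota-Baxter operator of weight $1$ on a Lie algebra $\mathfrak{g}$ is a linear map $R\colon\mathfrak{g}\to\mathfrak{g}$ with $[R(x),R(y)]=R([R(x),y]+[x,R(y)]+[x,y])$ for all $x,y\in\mathfrak{g}$. Sumless Sweedler notation $\Delta(x)=x_{(1)}\otimes x_{(2)}$ (and similarly for iterated comultiplications) is used. For a coalgebra $H$ with comultiplication $\Delta$ and counit $\epsilon$, a linear map $B\colon H\to H$ is a coalgebra map if $\Delta(B(x))=B(x_{(1)})\otimes B(x_{(2)})$ and $\epsilon(B(x))=\epsilon(x)$ for all $x\in H$. If $H$ is a cocommutative Hopf algebra with antipode $S$, a Rota-Baxter operator on $H$ is a coalgebra map $B\colon H\to H$ such that $B(x)B(y)=B\big(x_{(1)}B(x_{(2)})\,y\,S(B(x_{(3)}))\big)$ for all $x,y\in H$. $U(\mathfrak{g})$ is the universal enveloping algebra of $\mathfrak{g}$ with its usual cocommutative Hopf algebra structure, in which the elements of $\mathfrak{g}$ are primitive. *)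

theory Defs
  imports Complex_Main "HOL-Library.Multiset" "HOL-Library.Poly_Mapping"
begin

text \<open>
  The type \<open>'a list \<Rightarrow>\<^sub>0 'k\<close> is the vector space over \<open>'k\<close> with the words in \<open>'a\<close> as a basis.
  Dividing it by the span of \<open>multilinear_rels scale\<close> gives the tensor algebra of the vector
  space \<open>('a, scale)\<close>, a word \<open>[x\<^sub>1, \<dots>, x\<^sub>n]\<close> being mapped to \<open>x\<^sub>1 \<otimes> \<dots> \<otimes> x\<^sub>n\<close>. The relations
  preserve the length of words, so the words of length \<open>n\<close> yield the \<open>n\<close>-th tensor power.
\<close>

definition fscale :: "'k::field \<Rightarrow> ('x \<Rightarrow>\<^sub>0 'k) \<Rightarrow> ('x \<Rightarrow>\<^sub>0 'k)" where
  "fscale c p = Poly_Mapping.map ((*) c) p"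

definition multilinear_rels ::
    "('k::field \<Rightarrow> 'a::ab_group_add \<Rightarrow> 'a) \<Rightarrow> ('a list \<Rightarrow>\<^sub>0 'k) set" where
  "multilinear_rels scale =
     {Poly_Mapping.single (us @ [x + y] @ vs) 1
        - Poly_Mapping.single (us @ [x] @ vs) 1
        - Poly_Mapping.single (us @ [y] @ vs) 1 | us x y vs. True}
   \<union> {Poly_Mapping.single (us @ [scale c x] @ vs) 1
        - Poly_Mapping.single (us @ [x] @ vs) c | us c x vs. True}"


locale lie_algebra = vector_space scale
  for scale :: "'k::field \<Rightarrow> 'g::ab_group_add \<Rightarrow> 'g" +
  fixes bracket :: "'g \<Rightarrow> 'g \<Rightarrow> 'g"
  assumes linear_bracket_left: "Vector_Spaces.linear scale scale (\<lambda>x. bracket x y)"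
    and linear_bracket_right: "Vector_Spaces.linear scale scale (\<lambda>y. bracket x y)"
    and bracket_self: "bracket x x = 0"
    and jacobi: "bracket x (bracket y z) + bracket y (bracket z x) + bracket z (bracket x y) = 0"

definition rota_baxter_lie ::
    "('k::field \<Rightarrow> 'g::ab_group_add \<Rightarrow> 'g) \<Rightarrow> ('g \<Rightarrow> 'g \<Rightarrow> 'g) \<Rightarrow> ('g \<Rightarrow> 'g) \<Rightarrow> bool" where
  "rota_baxter_lie scale bracket R \<longleftrightarrow>
     Vector_Spaces.linear scale scale R \<and>
     (\<forall>x y. bracket (R x) (R y) = R (bracket (R x) y + bracket x (R y) + bracket x y))"


locale associative_algebra = vector_space scale
  for scale :: "'k::field \<Rightarrow> 'a::ring_1 \<Rightarrow> 'a" +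
  assumes scale_mult_left: "scale c x * y = scale c (x * y)"
    and scale_mult_right: "x * scale c y = scale c (x * y)"

text \<open>
  \<open>U\<close> is the quotient of the tensor algebra by the two-sided ideal generated by all
  \<open>x \<otimes> y - y \<otimes> x - [x, y]\<close>. Since the words span the free algebra, the elements of
  \<open>enveloping_rels\<close> span the preimage of this ideal in the free algebra on the set \<open>'g\<close>.
\<close>

definition enveloping_rels ::
    "('k::field \<Rightarrow> 'g::ab_group_add \<Rightarrow> 'g) \<Rightarrow> ('g \<Rightarrow> 'g \<Rightarrow> 'g) \<Rightarrow> ('g list \<Rightarrow>\<^sub>0 'k) set" where
  "enveloping_rels scale bracket =
     multilinear_rels scale
   \<union> {Poly_Mapping.single (us @ [x, y] @ vs) 1
        - Poly_Mapping.single (us @ [y, x] @ vs) 1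
        - Poly_Mapping.single (us @ [bracket x y] @ vs) 1 | us x y vs. True}"

definition word_eval ::
    "('k::field \<Rightarrow> 'u::ring_1 \<Rightarrow> 'u) \<Rightarrow> ('g \<Rightarrow> 'u) \<Rightarrow> ('g list \<Rightarrow>\<^sub>0 'k) \<Rightarrow> 'u" where
  "word_eval scaleU \<iota> p =
     (\<Sum>w\<in>Poly_Mapping.keys p. scaleU (Poly_Mapping.lookup p w) (prod_list (map \<iota> w)))"

text \<open>
  The type of the quotient cannot depend on \<open>scale\<close> and \<open>bracket\<close>. Instead, \<open>('u, scaleU)\<close> together
  with \<open>\<iota>\<close> is required to be isomorphic to the quotient: the canonical algebra homomorphism
  from the free algebra is surjective and its kernel is the ideal above.
\<close>

locale universal_enveloping_algebra =
  lie_algebra scale bracket + U: associative_algebra scaleU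
  for scale :: "'k::field \<Rightarrow> 'g::ab_group_add \<Rightarrow> 'g"
    and bracket :: "'g \<Rightarrow> 'g \<Rightarrow> 'g"
    and scaleU :: "'k \<Rightarrow> 'u::ring_1 \<Rightarrow> 'u" +
  fixes \<iota> :: "'g \<Rightarrow> 'u"
  assumes surj_word_eval: "surj (word_eval scaleU \<iota> :: ('g list \<Rightarrow>\<^sub>0 'k) \<Rightarrow> 'u)"
    and kernel_word_eval:
      "{p. word_eval scaleU \<iota> p = 0} = module.span fscale (enveloping_rels scale bracket)"


text \<open>
  An element of a tensor power is represented by a finite formal sum of words, that is, by a
  multiset of words. Every tensor is of this form, as scalars can be moved into the factors.
\<close>

definition same_tensor ::
    "('k::field \<Rightarrow> 'a::ab_group_add \<Rightarrow> 'a) \<Rightarrow> 'a list multiset \<Rightarrow> 'a list multiset \<Rightarrow> bool" where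
  "same_tensor scale M N \<longleftrightarrow>
     (\<Sum>w\<in>#M. Poly_Mapping.single w 1) - (\<Sum>w\<in>#N. Poly_Mapping.single w 1)
       \<in> module.span fscale (multilinear_rels scale)"

definition same_tensor2 ::
    "('k::field \<Rightarrow> 'a::ab_group_add \<Rightarrow> 'a) \<Rightarrow> ('a \<times> 'a) multiset \<Rightarrow> ('a \<times> 'a) multiset \<Rightarrow> bool" where
  "same_tensor2 scale M N \<longleftrightarrow>
     same_tensor scale (image_mset (\<lambda>(a, b). [a, b]) M) (image_mset (\<lambda>(a, b). [a, b]) N)"

text \<open>
  A comultiplication is given by a choice of a Sweedler sum: \<open>\<Delta> x\<close> is a multiset of pairs
  \<open>(x\<^sub>(\<^sub>1\<^sub>), x\<^sub>(\<^sub>2\<^sub>))\<close> representing the tensor \<open>\<Sum> x\<^sub>(\<^sub>1\<^sub>) \<otimes> x\<^sub>(\<^sub>2\<^sub>)\<close>. Equations between tensors are therefore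
  stated up to \<open>same_tensor\<close>, and an expression that is bilinear in \<open>x\<^sub>(\<^sub>1\<^sub>)\<close> and \<open>x\<^sub>(\<^sub>2\<^sub>)\<close>, summed over
  \<open>\<Delta> x\<close>, does not depend on the choice.
\<close>

locale coalgebra = vector_space scale
  for scale :: "'k::field \<Rightarrow> 'a::ab_group_add \<Rightarrow> 'a" +
  fixes \<Delta> :: "'a \<Rightarrow> ('a \<times> 'a) multiset"
    and \<epsilon> :: "'a \<Rightarrow> 'k"
  assumes comult_add: "same_tensor2 scale (\<Delta> (x + y)) (\<Delta> x + \<Delta> y)"
    and comult_scale:
      "same_tensor2 scale (\<Delta> (scale c x)) (image_mset (\<lambda>(a, b). (scale c a, b)) (\<Delta> x))"
    and linear_counit: "Vector_Spaces.linear scale (*) \<epsilon>"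
    and coassoc:
      "same_tensor scale
         (\<Sum>(a, b)\<in>#\<Delta> x. image_mset (\<lambda>(c, d). [c, d, b]) (\<Delta> a))
         (\<Sum>(a, b)\<in>#\<Delta> x. image_mset (\<lambda>(c, d). [a, c, d]) (\<Delta> b))"
    and counit_left: "(\<Sum>(a, b)\<in>#\<Delta> x. scale (\<epsilon> a) b) = x"
    and counit_right: "(\<Sum>(a, b)\<in>#\<Delta> x. scale (\<epsilon> b) a) = x"

locale bialgebra = associative_algebra scale + coalgebra scale \<Delta> \<epsilon>
  for scale :: "'k::field \<Rightarrow> 'a::ring_1 \<Rightarrow> 'a"
    and \<Delta> :: "'a \<Rightarrow> ('a \<times> 'a) multiset"
    and \<epsilon> :: "'a \<Rightarrow> 'k" +
  assumes comult_mult: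
      "same_tensor2 scale (\<Delta> (x * y)) (\<Sum>(a, b)\<in>#\<Delta> x. image_mset (\<lambda>(c, d). (a * c, b * d)) (\<Delta> y))"
    and comult_one: "same_tensor2 scale (\<Delta> 1) {#(1, 1)#}"
    and counit_mult: "\<epsilon> (x * y) = \<epsilon> x * \<epsilon> y"
    and counit_one: "\<epsilon> 1 = 1"

locale hopf_algebra = bialgebra scale \<Delta> \<epsilon>
  for scale :: "'k::field \<Rightarrow> 'a::ring_1 \<Rightarrow> 'a"
    and \<Delta> :: "'a \<Rightarrow> ('a \<times> 'a) multiset"
    and \<epsilon> :: "'a \<Rightarrow> 'k" +
  fixes S :: "'a \<Rightarrow> 'a"
  assumes linear_antipode: "Vector_Spaces.linear scale scale S"
    and antipode_left: "(\<Sum>(a, b)\<in>#\<Delta> x. S a * b) = scale (\<epsilon> x) 1"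
    and antipode_right: "(\<Sum>(a, b)\<in>#\<Delta> x. a * S b) = scale (\<epsilon> x) 1"

locale cocommutative_hopf_algebra = hopf_algebra +
  assumes cocommutative: "same_tensor2 scale (image_mset prod.swap (\<Delta> x)) (\<Delta> x)"

definition coalgebra_map ::
    "('k::field \<Rightarrow> 'a::ab_group_add \<Rightarrow> 'a) \<Rightarrow> ('a \<Rightarrow> ('a \<times> 'a) multiset) \<Rightarrow> ('a \<Rightarrow> 'k)
      \<Rightarrow> ('a \<Rightarrow> 'a) \<Rightarrow> bool" where
  "coalgebra_map scale \<Delta> \<epsilon> B \<longleftrightarrow>
     Vector_Spaces.linear scale scale B \<and>
     (\<forall>x. same_tensor2 scale (\<Delta> (B x)) (image_mset (\<lambda>(a, b). (B a, B b)) (\<Delta> x))) \<and>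
     (\<forall>x. \<epsilon> (B x) = \<epsilon> x)"

text \<open>
  The iterated comultiplication is expanded as \<open>(\<Delta> \<otimes> id) (\<Delta> x)\<close>: below \<open>a, b, c\<close> stand for
  \<open>x\<^sub>(\<^sub>1\<^sub>), x\<^sub>(\<^sub>2\<^sub>), x\<^sub>(\<^sub>3\<^sub>)\<close>.
\<close>

definition rota_baxter_hopf ::
    "('k::field \<Rightarrow> 'a::ring_1 \<Rightarrow> 'a) \<Rightarrow> ('a \<Rightarrow> ('a \<times> 'a) multiset) \<Rightarrow> ('a \<Rightarrow> 'k) \<Rightarrow> ('a \<Rightarrow> 'a)
      \<Rightarrow> ('a \<Rightarrow> 'a) \<Rightarrow> bool" where
  "rota_baxter_hopf scale \<Delta> \<epsilon> S B \<longleftrightarrow>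
     coalgebra_map scale \<Delta> \<epsilon> B \<and>
     (\<forall>x y. B x * B y = B (\<Sum>(u, c)\<in>#\<Delta> x. \<Sum>(a, b)\<in>#\<Delta> u. a * B b * y * S (B c)))"

text \<open>
  The equation for \<open>\<Delta> (\<iota> x)\<close> determines \<open>\<Delta>\<close> up to the choice of Sweedler sums, and with it
  \<open>\<epsilon>\<close> and \<open>S\<close>, because \<open>\<iota>\<close> generates the algebra.
\<close>

locale enveloping_hopf_algebra =
  universal_enveloping_algebra scale bracket scaleU \<iota> +
  U: cocommutative_hopf_algebra scaleU \<Delta> \<epsilon> S
  for scale :: "'k::field \<Rightarrow> 'g::ab_group_add \<Rightarrow> 'g"
    and bracket :: "'g \<Rightarrow> 'g \<Rightarrow> 'g"
    and scaleU :: "'k \<Rightarrow> 'u::ring_1 \<Rightarrow> 'u"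
    and \<iota> :: "'g \<Rightarrow> 'u"
    and \<Delta> :: "'u \<Rightarrow> ('u \<times> 'u) multiset"
    and \<epsilon> :: "'u \<Rightarrow> 'k"
    and S :: "'u \<Rightarrow> 'u" +
  assumes primitive: "same_tensor2 scaleU (\<Delta> (\<iota> x)) {#(\<iota> x, 1), (1, \<iota> x)#}"

end

theory Submission
  imports Defs
begin

text \<open>
  An operator \<open>B\<close> on \<open>U(g)\<close> fixes \<open>1\<close> and preserves primitive elements, which are the elements of
  \<open>g\<close> because multiplication after comultiplication acts on words of length \<open>n\<close> as \<open>2 ^ n\<close> modulo
  shorter words. So \<open>B\<close> restricts to a map \<open>R\<close> on \<open>g\<close>, and antisymmetrizing
  \<open>B x * B y = B (x y + [B x, y])\<close> for \<open>x, y\<close> in \<open>g\<close> shows that \<open>R\<close> is a Rota-Baxter operator. For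
  \<open>x\<close> in \<open>g\<close> and \<open>u\<close> in \<open>U(g)\<close> the identity reads \<open>B (L\<^sub>x u) = R x * B u\<close> where
  \<open>L\<^sub>x u = x u + [R x, u]\<close>. Since \<open>[R x, u]\<close> is no longer than \<open>u\<close>, the operators \<open>L\<^sub>x\<close> generate
  \<open>U(g)\<close> from \<open>1\<close>, so \<open>R\<close> determines \<open>B\<close>. Conversely, this recursion defines a map on words that
  respects the defining relations of \<open>U(g)\<close>, and the axioms for \<open>B\<close> follow by induction along the
  \<open>L\<^sub>x\<close>, which are coderivations. Of the PBW theorem only the
  injectivity of \<open>g \<rightarrow> U(g)\<close> is needed.
\<close>

subsection \<open>Formal sums and linear functionals\<close>

lemma lookup_fscale [simp]: "Poly_Mapping.lookup (fscale c p) w = c * Poly_Mapping.lookup p w"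
  by (auto simp: fscale_def Poly_Mapping.map.rep_eq when_def)

lemma vector_space_fscale: "vector_space fscale"
  by unfold_locales (auto intro!: poly_mapping_eqI simp: lookup_add algebra_simps)

lemma vector_space_mult: "vector_space ((*) :: 'k::field \<Rightarrow> 'k \<Rightarrow> 'k)"
  by unfold_locales (auto simp: algebra_simps)

definition linear_extension ::
    "('k::field \<Rightarrow> 'b::ab_group_add \<Rightarrow> 'b) \<Rightarrow> ('x \<Rightarrow> 'b) \<Rightarrow> ('x \<Rightarrow>\<^sub>0 'k) \<Rightarrow> 'b" where
  "linear_extension s f p =
     (\<Sum>w\<in>Poly_Mapping.keys p. s (Poly_Mapping.lookup p w) (f w))"

context vector_space
begin

lemma linear_extension_superset:
  assumes "finite A" "Poly_Mapping.keys p \<subseteq> A"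
  shows "linear_extension scale f p = (\<Sum>w\<in>A. scale (Poly_Mapping.lookup p w) (f w))"
  unfolding linear_extension_def using assms
  by (intro sum.mono_neutral_left) (auto simp: in_keys_iff)

lemma linear_extension_single [simp]:
  "linear_extension scale f (Poly_Mapping.single w c) = scale c (f w)"
  by (subst linear_extension_superset[of "{w}"]) auto

lemma linear_linear_extension: "Vector_Spaces.linear fscale scale (linear_extension scale f)"
  unfolding Vector_Spaces.linear_iff
proof (intro conjI allI)
  show "vector_space fscale" by (rule vector_space_fscale)
  show "vector_space scale" by unfold_locales
  show "linear_extension scale f (p + q) = linear_extension scale f p + linear_extension scale f q"
    for p q
  proof -
    let ?A = "Poly_Mapping.keys p \<union> Poly_Mapping.keys q"
    have "Poly_Mapping.keys (p + q) \<subseteq> ?A" by (rule keys_add)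
    then show ?thesis
      by (simp add: linear_extension_superset[of ?A] lookup_add scale_left_distrib sum.distrib)
  qed
  show "linear_extension scale f (fscale c p) = scale c (linear_extension scale f p)" for c p
  proof -
    have "Poly_Mapping.keys (fscale c p) \<subseteq> Poly_Mapping.keys p"
      by (auto simp: in_keys_iff)
    then show ?thesis
      by (simp add: linear_extension_superset[of "Poly_Mapping.keys p"] scale_sum_right)
  qed
qed

text \<open>A basis of \<open>span V\<close> stays independent when \<open>p\<close> is added, so a
  functional may be prescribed to be 1 at \<open>p\<close> and 0 on that basis. It serves to tell
  unequal tensors apart.\<close>

lemma separating_functional:
  assumes "p \<notin> span V"
  shows "\<exists>\<phi>. Vector_Spaces.linear scale (*) \<phi> \<and> (\<forall>x\<in>V. \<phi> x = 0) \<and> \<phi> p = 1"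
proof -
  interpret vs: vector_space_pair scale "(*)"
    by (intro vector_space_pair.intro vector_space_mult) unfold_locales
  obtain B where B: "B \<subseteq> V" "independent B" "V \<subseteq> span B"
    using maximal_independent_subset by blast
  have "span V = span B" using B by (metis span_mono span_span subset_antisym)
  then have p: "p \<notin> span B" using assms by simp
  obtain \<phi> where \<phi>: "Vector_Spaces.linear scale (*) \<phi>"
      "\<forall>x\<in>insert p B. \<phi> x = (if x = p then 1 else 0)"
    using vs.linear_independent_extend[OF independent_insertI[OF p B(2)], of "\<lambda>x. if x = p then 1 else 0"]
    by blast
  interpret \<phi>: Vector_Spaces.linear scale "(*)" \<phi> by (rule \<phi>)
  have "\<phi> x = 0" if "x \<in> B" for x
    using \<phi>(2) that p span_base by auto
  then have "\<phi> x = 0" if "x \<in> V" for x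
    using \<phi>.eq_0_on_span[of B x] B(3) that by blast
  then show ?thesis using \<phi> by auto
qed

end

text \<open>Functions live on words of all lengths at once; fixing the length \<open>n\<close> lets
  multilinearity of recursively defined functions be proved by induction on the length.\<close>

definition multilinear ::
    "('k::field \<Rightarrow> 'a::ab_group_add \<Rightarrow> 'a) \<Rightarrow> ('k \<Rightarrow> 'b::ab_group_add \<Rightarrow> 'b) \<Rightarrow> nat \<Rightarrow>
      ('a list \<Rightarrow> 'b) \<Rightarrow> bool" where
  "multilinear s s' n f \<longleftrightarrow>
     (\<forall>us vs x y. Suc (length us + length vs) = n \<longrightarrow>
        f (us @ (x + y) # vs) = f (us @ x # vs) + f (us @ y # vs)) \<and>
     (\<forall>us vs c x. Suc (length us + length vs) = n \<longrightarrow> f (us @ s c x # vs) = s' c (f (us @ x # vs)))"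

definition bilinear ::
    "('k::field \<Rightarrow> 'a::ab_group_add \<Rightarrow> 'a) \<Rightarrow> ('k \<Rightarrow> 'b::ab_group_add \<Rightarrow> 'b) \<Rightarrow>
      ('a \<Rightarrow> 'a \<Rightarrow> 'b) \<Rightarrow> bool" where
  "bilinear s s' f \<longleftrightarrow>
     (\<forall>x x' y. f (x + x') y = f x y + f x' y) \<and> (\<forall>x y y'. f x (y + y') = f x y + f x y') \<and>
     (\<forall>c x y. f (s c x) y = s' c (f x y)) \<and> (\<forall>c x y. f x (s c y) = s' c (f x y))"

definition trilinear ::
    "('k::field \<Rightarrow> 'a::ab_group_add \<Rightarrow> 'a) \<Rightarrow> ('k \<Rightarrow> 'b::ab_group_add \<Rightarrow> 'b) \<Rightarrow>
      ('a \<Rightarrow> 'a \<Rightarrow> 'a \<Rightarrow> 'b) \<Rightarrow> bool" where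
  "trilinear s s' f \<longleftrightarrow>
     (\<forall>z. bilinear s s' (\<lambda>x y. f x y z)) \<and>
     (\<forall>x y z z'. f x y (z + z') = f x y z + f x y z') \<and> (\<forall>c x y z. f x y (s c z) = s' c (f x y z))"

context
  fixes s :: "'k::field \<Rightarrow> 'a::ab_group_add \<Rightarrow> 'a" and s' :: "'k \<Rightarrow> 'b::ab_group_add \<Rightarrow> 'b"
  assumes vs': "vector_space s'"
begin

interpretation T: vector_space s' by (rule vs')
interpretation F: vector_space "fscale :: 'k \<Rightarrow> ('x \<Rightarrow>\<^sub>0 'k) \<Rightarrow> _" by (rule vector_space_fscale)

text \<open>The linear extension of \<open>f\<close> kills the multilinear relations, hence their
  span. The values may lie in any vector space, in particular in the algebra itself.\<close>

lemma sum_eq_if_same_tensor: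
  assumes "same_tensor s M N" and f: "\<And>n. multilinear s s' n f"
  shows "(\<Sum>w\<in>#M. f w) = (\<Sum>w\<in>#N. f w)"
proof -
  interpret L: Vector_Spaces.linear fscale s' "linear_extension s' f"
    by (rule T.linear_linear_extension)
  have "linear_extension s' f r = 0" if "r \<in> multilinear_rels s" for r
    using that f unfolding multilinear_rels_def multilinear_def
    by (auto simp: L.diff)
  then have "linear_extension s' f r = 0" if "r \<in> F.span (multilinear_rels s)" for r
    using L.eq_0_on_span[of "multilinear_rels s" r] that by blast
  then have "linear_extension s' f ((\<Sum>w\<in>#M. Poly_Mapping.single w 1)
      - (\<Sum>w\<in>#N. Poly_Mapping.single w 1)) = 0"
    using assms(1) unfolding same_tensor_def by blast
  moreover have "linear_extension s' f (\<Sum>w\<in>#K. Poly_Mapping.single w 1) = (\<Sum>w\<in>#K. f w)" for K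
    by (induction K) (auto simp: L.add)
  ultimately show ?thesis
    by (simp add: L.diff)
qed

lemma sum_eq_if_same_tensor2:
  assumes "same_tensor2 s M N" and f: "bilinear s s' f"
  shows "(\<Sum>(a, b)\<in>#M. f a b) = (\<Sum>(a, b)\<in>#N. f a b)"
proof -
  define g where "g w = (case w of [a, b] \<Rightarrow> f a b | _ \<Rightarrow> 0)" for w
  have "multilinear s s' n g" for n
    using f unfolding multilinear_def bilinear_def g_def
    by (auto split: list.splits simp: Cons_eq_append_conv append_eq_Cons_conv)
  from sum_eq_if_same_tensor[OF assms(1)[unfolded same_tensor2_def] this]
  show ?thesis
    by (simp add: multiset.map_comp comp_def case_prod_unfold g_def)
qed

lemma sum_eq_if_same_tensor3:
  assumes "same_tensor s (\<Sum>p\<in>#M. image_mset (\<lambda>q. [k1 p q, k2 p q, k3 p q]) (P p))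
      (\<Sum>p\<in>#N. image_mset (\<lambda>q. [l1 p q, l2 p q, l3 p q]) (Q p))"
    and f: "trilinear s s' f"
  shows "(\<Sum>p\<in>#M. \<Sum>q\<in>#P p. f (k1 p q) (k2 p q) (k3 p q))
    = (\<Sum>p\<in>#N. \<Sum>q\<in>#Q p. f (l1 p q) (l2 p q) (l3 p q))"
proof -
  define g where "g w = (case w of [a, b, c] \<Rightarrow> f a b c | _ \<Rightarrow> 0)" for w
  have 1: "multilinear s s' n g" for n
    using f unfolding multilinear_def trilinear_def bilinear_def g_def
    by (auto split: list.splits simp: Cons_eq_append_conv append_eq_Cons_conv)
  have 2: "(\<Sum>w\<in>#(\<Sum>p\<in>#M. image_mset (\<lambda>q. [k1 p q, k2 p q, k3 p q]) (P p)). g w)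
    = (\<Sum>p\<in>#M. \<Sum>q\<in>#P p. f (k1 p q) (k2 p q) (k3 p q))" for M and k1 k2 k3 :: "'p \<Rightarrow> 'q \<Rightarrow> 'a" and P
    by (induction M) (auto simp: multiset.map_comp comp_def g_def)
  show ?thesis
    using sum_eq_if_same_tensor[OF assms(1) 1] unfolding 2 .
qed

end

text \<open>If the difference of the two formal sums lies outside the span of the relations, some
  functional vanishes on the relations but not on the difference. Restricted to words of length two,
  that functional is a bilinear form.\<close>

lemma same_tensor2_iff:
  assumes "vector_space s"
  shows "same_tensor2 s M N \<longleftrightarrow>
    (\<forall>\<beta>. bilinear s (*) \<beta> \<longrightarrow> (\<Sum>(a, b)\<in>#M. \<beta> a b) = (\<Sum>(a, b)\<in>#N. \<beta> a b))"
proof (intro iffI allI impI)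
  show "(\<Sum>(a, b)\<in>#M. \<beta> a b) = (\<Sum>(a, b)\<in>#N. \<beta> a b)"
    if "same_tensor2 s M N" "bilinear s (*) \<beta>" for \<beta>
    using sum_eq_if_same_tensor2[OF vector_space_mult that] .
next
  interpret F: vector_space "fscale :: 'k::field \<Rightarrow> ('x \<Rightarrow>\<^sub>0 'k) \<Rightarrow> _" by (rule vector_space_fscale)
  assume *: "\<forall>\<beta>. bilinear s (*) \<beta> \<longrightarrow> (\<Sum>(a, b)\<in>#M. \<beta> a b) = (\<Sum>(a, b)\<in>#N. \<beta> a b)"
  let ?t = "\<lambda>K. \<Sum>w\<in>#image_mset (\<lambda>(a, b). [a, b]) K. Poly_Mapping.single w 1"
  show "same_tensor2 s M N"
  proof (rule ccontr)
    assume "\<not> same_tensor2 s M N"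
    then have "?t M - ?t N \<notin> F.span (multilinear_rels s)"
      by (simp add: same_tensor2_def same_tensor_def)
    then obtain \<phi> where \<phi>: "Vector_Spaces.linear fscale (*) \<phi>"
        "\<And>r. r \<in> multilinear_rels s \<Longrightarrow> \<phi> r = 0" "\<phi> (?t M - ?t N) = 1"
      using F.separating_functional by blast
    interpret \<phi>: Vector_Spaces.linear fscale "(*)" \<phi> by (rule \<phi>)
    define \<beta> where "\<beta> a b = \<phi> (Poly_Mapping.single [a, b] 1)" for a b
    have add: "\<phi> (Poly_Mapping.single (us @ [x + y] @ vs) 1)
        = \<phi> (Poly_Mapping.single (us @ [x] @ vs) 1) + \<phi> (Poly_Mapping.single (us @ [y] @ vs) 1)"
      for us x y vs
      using \<phi>(2)[of "Poly_Mapping.single (us @ [x + y] @ vs) 1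
        - Poly_Mapping.single (us @ [x] @ vs) 1 - Poly_Mapping.single (us @ [y] @ vs) 1"]
      unfolding \<phi>.diff by (force simp: multilinear_rels_def algebra_simps)
    have scale: "\<phi> (Poly_Mapping.single (us @ [s c x] @ vs) 1)
        = c * \<phi> (Poly_Mapping.single (us @ [x] @ vs) 1)" for us c x vs
    proof -
      have "Poly_Mapping.single (us @ [x] @ vs) c = fscale c (Poly_Mapping.single (us @ [x] @ vs) 1)"
        by (intro poly_mapping_eqI) (simp add: lookup_single when_def)
      moreover have "Poly_Mapping.single (us @ [s c x] @ vs) 1 - Poly_Mapping.single (us @ [x] @ vs) c
          \<in> multilinear_rels s"
        unfolding multilinear_rels_def by blast
      ultimately show ?thesis
        using \<phi>(2) \<phi>.diff \<phi>.scale by (metis right_minus_eq)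
    qed
    have "bilinear s (*) \<beta>"
      using add[of "[]"] add[of "[_]" _ _ "[]"] scale[of "[]"] scale[of "[_]" _ _ "[]"]
      by (simp add: bilinear_def \<beta>_def)
    then have "(\<Sum>(a, b)\<in>#M. \<beta> a b) = (\<Sum>(a, b)\<in>#N. \<beta> a b)" using * by blast
    moreover have "\<phi> (?t K) = (\<Sum>(a, b)\<in>#K. \<beta> a b)" for K
      by (induction K) (auto simp: \<phi>.add \<beta>_def)
    ultimately show False using \<phi>(3) by (simp add: \<phi>.diff)
  qed
qed

subsection \<open>Linear maps on an enveloping algebra given on words\<close>

lemma multilinearD:
  assumes "multilinear s s' n f" "Suc (length us + length vs) = n"
  shows "f (us @ (x + y) # vs) = f (us @ x # vs) + f (us @ y # vs)"
    "f (us @ s c x # vs) = s' c (f (us @ x # vs))"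
  using assms unfolding multilinear_def by blast+

lemma multilinear_hd:
  assumes "multilinear s s' (Suc (length w)) f"
  shows "f ((x + y) # w) = f (x # w) + f (y # w)" "f (s c x # w) = s' c (f (x # w))"
  using multilinearD[OF assms, of "[]" w] by simp_all

lemma multilinear_Cons:
  assumes "multilinear s s' (Suc n) f"
  shows "multilinear s s' n (\<lambda>v. f (a # v))"
  unfolding multilinear_def using multilinearD[OF assms, of "a # us" for us] by simp

lemma multilinear_SucI:
  fixes f :: "'a::ab_group_add list \<Rightarrow> 'b::ab_group_add"
  assumes "\<And>w x y. length w = n \<Longrightarrow> f ((x + y) # w) = f (x # w) + f (y # w)"
    "\<And>w c x. length w = n \<Longrightarrow> f (s c x # w) = s' c (f (x # w))"
    "\<And>a. multilinear s s' n (\<lambda>v. f (a # v))"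
  shows "multilinear s s' (Suc n) f"
  unfolding multilinear_def
proof (intro conjI allI impI)
  fix us vs :: "'a list" and x y c
  assume *: "Suc (length us + length vs) = Suc n"
  show "f (us @ (x + y) # vs) = f (us @ x # vs) + f (us @ y # vs)"
    using * assms by (cases us) (auto simp: multilinear_def)
  show "f (us @ s c x # vs) = s' c (f (us @ x # vs))"
    using * assms by (cases us) (auto simp: multilinear_def)
qed

lemma multilinear_0: "multilinear s s' 0 f"
  by (simp add: multilinear_def)

section \<open>Bracket identities and the adjoint action on words\<close>

context lie_algebra
begin

lemma bracket_add: "bracket (x + y) z = bracket x z + bracket y z"
    "bracket x (y + z) = bracket x y + bracket x z"
  and bracket_scale: "bracket (scale c x) z = scale c (bracket x z)"
    "bracket x (scale c z) = scale c (bracket x z)"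
  using linear_bracket_left linear_bracket_right by (auto simp: Vector_Spaces.linear_iff)

lemma bracket_zero [simp]: "bracket 0 x = 0" "bracket x 0 = 0"
  using bracket_scale[where c = 0] by auto

lemma bracket_antisym: "bracket x y = - bracket y x"
proof -
  have "bracket (x + y) (x + y) = 0" by (rule bracket_self)
  then show ?thesis
    by (simp add: bracket_add bracket_self[of x] bracket_self[of y] eq_neg_iff_add_eq_0 add.commute)
qed

lemma bracket_minus: "bracket (- x) y = - bracket x y" "bracket x (- y) = - bracket x y"
  using bracket_scale[where c = "-1"] by auto

lemma bracket_bracket: "bracket x (bracket y z) = bracket (bracket x y) z + bracket y (bracket x z)"
proof -
  have "bracket (bracket x y) z = - bracket z (bracket x y)" by (rule bracket_antisym)
  moreover have "bracket x z = - bracket z x" by (rule bracket_antisym)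
  moreover have "bracket x (bracket y z) = - bracket z (bracket x y) - bracket y (bracket z x)"
    using jacobi[of x y z] unfolding eq_diff_eq eq_neg_iff_add_eq_0 .
  ultimately show ?thesis
    by (simp add: bracket_minus)
qed

end

text \<open>This is \<open>f\<close> evaluated at the image of the word under the derivation
  \<open>ad z\<close> of the tensor algebra. Letting the derivation act on \<open>f\<close> avoids
  formal sums of words.\<close>

primrec ad_sum :: "('g \<Rightarrow> 'g \<Rightarrow> 'g) \<Rightarrow> 'g \<Rightarrow> ('g list \<Rightarrow> 'b::ab_group_add) \<Rightarrow> 'g list \<Rightarrow> 'b" where
  "ad_sum br z f [] = 0"
| "ad_sum br z f (x # w) = f (br z x # w) + ad_sum br z (\<lambda>v. f (x # v)) w"

text \<open>Only words of the length of \<open>w\<close> are passed to \<open>f\<close>. As a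
  congruence rule this bounds the recursive calls of \<open>rb_word\<close> that are hidden inside
  \<open>ad_sum\<close>.\<close>

lemma ad_sum_cong [fundef_cong]:
  assumes "br = br'" "z = z'" "w = w'" "\<And>v. length v = length w' \<Longrightarrow> f v = g v"
  shows "ad_sum br z f w = ad_sum br' z' g w'"
  using assms(4) unfolding assms(1-3)
proof (induction w' arbitrary: f g)
  case (Cons x w)
  have "ad_sum br' z' (\<lambda>v. f (x # v)) w = ad_sum br' z' (\<lambda>v. g (x # v)) w"
    by (rule Cons.IH) (simp add: Cons.prems)
  then show ?case using Cons.prems[of "br' z' x # w"] by simp
qed simp

lemma ad_sum_append:
  "ad_sum br z f (u @ v) = ad_sum br z (\<lambda>u'. f (u' @ v)) u + ad_sum br z (\<lambda>v'. f (u @ v')) v"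
  by (induction u arbitrary: f) (simp_all add: add.assoc)

lemma ad_sum_add: "ad_sum br z (\<lambda>v. f v + g v) w = ad_sum br z f w + ad_sum br z g w"
  by (induction w arbitrary: f g) (auto simp: algebra_simps)

lemma ad_sum_diff: "ad_sum br z (\<lambda>v. f v - g v) w = ad_sum br z f w - ad_sum br z g w"
  by (induction w arbitrary: f g) (auto simp: algebra_simps)

lemma ad_sum_additive:
  assumes "\<And>x y. h (x + y) = h x + h y"
  shows "ad_sum br z (\<lambda>v. h (f v)) w = h (ad_sum br z f w)"
proof -
  have "h 0 = 0" using assms[of 0 0] by simp
  then show ?thesis
    by (induction w arbitrary: f) (auto simp: assms)
qed

context lie_algebra
begin

lemma multilinear_ad_sum:
  assumes s': "vector_space s'" and "multilinear scale s' n f"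
  shows "multilinear scale s' n (ad_sum bracket z f)"
  using assms(2)
proof (induction n arbitrary: f)
  case 0
  show ?case by (rule multilinear_0)
next
  case (Suc n)
  interpret T: vector_space s' by (rule s')
  show ?case
  proof (rule multilinear_SucI)
    fix w :: "'g list" and x y c assume w: "length w = n"
    note hd = multilinear_hd[of scale s' _ f]
    have "ad_sum bracket z (\<lambda>v. f ((x + y) # v)) w = ad_sum bracket z (\<lambda>v. f (x # v) + f (y # v)) w"
      using Suc.prems w by (intro ad_sum_cong) (auto intro!: hd)
    then show "ad_sum bracket z f ((x + y) # w) = ad_sum bracket z f (x # w) + ad_sum bracket z f (y # w)"
      using Suc.prems w by (simp add: bracket_add hd ad_sum_add)
    have "ad_sum bracket z (\<lambda>v. f (scale c x # v)) w = ad_sum bracket z (\<lambda>v. s' c (f (x # v))) w"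
      using Suc.prems w by (intro ad_sum_cong) (auto intro!: hd)
    also have "\<dots> = s' c (ad_sum bracket z (\<lambda>v. f (x # v)) w)"
      by (rule ad_sum_additive) (rule T.scale_right_distrib)
    finally show "ad_sum bracket z f (scale c x # w) = s' c (ad_sum bracket z f (x # w))"
      using Suc.prems w by (simp add: bracket_scale hd T.scale_right_distrib)
  next
    fix a
    have "multilinear scale s' n (\<lambda>v. f (bracket z a # v))"
         "multilinear scale s' n (ad_sum bracket z (\<lambda>v. f (a # v)))"
      by (intro Suc.IH multilinear_Cons[OF Suc.prems])+
    then show "multilinear scale s' n (\<lambda>v. ad_sum bracket z f (a # v))"
      by (simp add: multilinear_def T.scale_right_distrib)
  qed
qed

lemma ad_sum_linear:
  assumes s': "vector_space s'" and "multilinear scale s' (length w) f"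
  shows "ad_sum bracket (z + z') f w = ad_sum bracket z f w + ad_sum bracket z' f w"
    and "ad_sum bracket (scale c z) f w = s' c (ad_sum bracket z f w)"
proof -
  interpret T: vector_space s' by (rule s')
  show "ad_sum bracket (z + z') f w = ad_sum bracket z f w + ad_sum bracket z' f w"
    and "ad_sum bracket (scale c z) f w = s' c (ad_sum bracket z f w)"
    using assms(2)
    by (induction w arbitrary: f)
      (auto simp: bracket_add bracket_scale multilinear_hd[of scale s' _ f for f]
        multilinear_Cons T.scale_right_distrib)
qed

text \<open>\<open>ad_sum\<close> acts by precomposition, which reverses the order of the
  derivations and explains \<open>bracket y x\<close> on the right. Terms in which \<open>x\<close>
  and \<open>y\<close> act on different letters cancel; on a single letter the claim is the Jacobi
  identity.\<close>

lemma ad_sum_bracket: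
  assumes "multilinear scale s' (length w) f"
  shows "ad_sum bracket x (ad_sum bracket y f) w - ad_sum bracket y (ad_sum bracket x f) w
    = ad_sum bracket (bracket y x) f w"
  using assms
proof (induction w arbitrary: f)
  case Nil
  show ?case by simp
next
  case (Cons a w)
  have "f (bracket y (bracket x a) # w)
      = f (bracket (bracket y x) a # w) + f (bracket x (bracket y a) # w)"
    using Cons.prems by (subst bracket_bracket) (simp add: multilinear_hd)
  moreover have "multilinear scale s' (length w) (\<lambda>v. f (a # v))"
    using Cons.prems by (simp add: multilinear_Cons)
  note Cons.IH[OF this]
  ultimately show ?case
    by (simp add: ad_sum_add algebra_simps)
qed

end

section \<open>Relations and universal property of the enveloping algebra\<close>

context universal_enveloping_algebra
begin

lemma word_eval_eq: "word_eval scaleU \<iota> = linear_extension scaleU (\<lambda>w. prod_list (map \<iota> w))"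
  by (simp add: word_eval_def linear_extension_def fun_eq_iff)

lemma \<iota>_add: "\<iota> (x + y) = \<iota> x + \<iota> y"
  and \<iota>_scale: "\<iota> (scale c x) = scaleU c (\<iota> x)"
  and \<iota>_bracket: "\<iota> (bracket x y) = \<iota> x * \<iota> y - \<iota> y * \<iota> x"
proof -
  interpret F: vector_space "fscale :: 'k \<Rightarrow> ('g list \<Rightarrow>\<^sub>0 'k) \<Rightarrow> _" by (rule vector_space_fscale)
  interpret L: Vector_Spaces.linear fscale scaleU "word_eval scaleU \<iota>"
    unfolding word_eval_eq by (rule U.linear_linear_extension)
  have *: "word_eval scaleU \<iota> r = 0" if "r \<in> enveloping_rels scale bracket" for r
    using that kernel_word_eval F.span_base by blast
  have "word_eval scaleU \<iota> (Poly_Mapping.single ([] @ [x + y] @ []) 1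
      - Poly_Mapping.single ([] @ [x] @ []) 1 - Poly_Mapping.single ([] @ [y] @ []) 1) = 0"
    by (rule *, unfold enveloping_rels_def multilinear_rels_def) blast
  then show "\<iota> (x + y) = \<iota> x + \<iota> y"
    unfolding L.diff unfolding word_eval_eq by (simp add: algebra_simps)
  have "word_eval scaleU \<iota> (Poly_Mapping.single ([] @ [scale c x] @ []) 1
      - Poly_Mapping.single ([] @ [x] @ []) c) = 0"
    by (rule *, unfold enveloping_rels_def multilinear_rels_def) blast
  then show "\<iota> (scale c x) = scaleU c (\<iota> x)"
    unfolding L.diff unfolding word_eval_eq by (simp add: algebra_simps)
  have "word_eval scaleU \<iota> (Poly_Mapping.single ([] @ [x, y] @ []) 1
      - Poly_Mapping.single ([] @ [y, x] @ []) 1 - Poly_Mapping.single ([] @ [bracket x y] @ []) 1) = 0"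
    by (rule *, unfold enveloping_rels_def multilinear_rels_def) blast
  then show "\<iota> (bracket x y) = \<iota> x * \<iota> y - \<iota> y * \<iota> x"
    unfolding L.diff unfolding word_eval_eq by (simp add: algebra_simps)
qed

lemma span_words: "U.span (range (\<lambda>w. prod_list (map \<iota> w))) = UNIV"
proof -
  have "word_eval scaleU \<iota> p \<in> U.span (range (\<lambda>w. prod_list (map \<iota> w)))" for p
    unfolding word_eval_def by (intro U.span_sum U.span_scale U.span_base) auto
  then show ?thesis using surj_word_eval by (metis UNIV_eq_I surjD)
qed

text \<open>Multilinearity and \<open>rel\<close> say that the linear extension of \<open>f\<close>
  kills the generators of the kernel of \<open>word_eval\<close>, so it factors through this
  surjection.\<close>

lemma linear_map_of_word_function:
  assumes s': "vector_space s'" and f: "\<And>n. multilinear scale s' n f"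
    and rel: "\<And>us x y vs. f (us @ x # y # vs) - f (us @ y # x # vs) = f (us @ bracket x y # vs)"
  shows "\<exists>F. Vector_Spaces.linear scaleU s' F \<and> (\<forall>w. F (prod_list (map \<iota> w)) = f w)"
proof -
  interpret T: vector_space s' by (rule s')
  interpret F: vector_space "fscale :: 'k \<Rightarrow> ('g list \<Rightarrow>\<^sub>0 'k) \<Rightarrow> _" by (rule vector_space_fscale)
  interpret L: Vector_Spaces.linear fscale scaleU "word_eval scaleU \<iota>"
    unfolding word_eval_eq by (rule U.linear_linear_extension)
  interpret f: Vector_Spaces.linear fscale s' "linear_extension s' f"
    by (rule T.linear_linear_extension)
  \<comment> \<open>The value is computed at an arbitrary preimage; \<open>ker\<close> makes the
    choice immaterial.\<close>
  define F where "F u = linear_extension s' f (SOME p. word_eval scaleU \<iota> p = u)" for u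
  have f': "f (us @ (x + y) # vs) = f (us @ x # vs) + f (us @ y # vs)"
      "f (us @ scale c x # vs) = s' c (f (us @ x # vs))" for us vs x y c
    by (rule multilinearD[OF f refl])+
  have *: "linear_extension s' f r = 0" if "r \<in> enveloping_rels scale bracket" for r
    using that unfolding enveloping_rels_def multilinear_rels_def
    by (elim UnE CollectE exE conjE) (simp_all add: f.diff f' rel)
  have ker: "linear_extension s' f p = 0" if "word_eval scaleU \<iota> p = 0" for p
  proof -
    have "p \<in> F.span (enveloping_rels scale bracket)"
      unfolding kernel_word_eval[symmetric] using that by simp
    from f.eq_0_on_span[OF _ this] * show ?thesis by blast
  qed
  have F: "F (word_eval scaleU \<iota> p) = linear_extension s' f p" for p
  proof -
    let ?q = "SOME q. word_eval scaleU \<iota> q = word_eval scaleU \<iota> p"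
    have "word_eval scaleU \<iota> ?q = word_eval scaleU \<iota> p" by (rule someI) simp
    then have "linear_extension s' f (?q - p) = 0"
      by (intro ker) (simp add: L.diff)
    then show ?thesis by (simp add: F_def f.diff)
  qed
  have "Vector_Spaces.linear scaleU s' F"
    unfolding Vector_Spaces.linear_iff
  proof (intro conjI allI)
    fix u v c
    obtain p q where "u = word_eval scaleU \<iota> p" "v = word_eval scaleU \<iota> q"
      using surj_word_eval by (meson surjD)
    then show "F (u + v) = F u + F v" "F (scaleU c u) = s' c (F u)"
      by (simp_all add: F L.add[symmetric] L.scale[symmetric] f.add f.scale)
    show "vector_space scaleU" by (rule U.vector_space_axioms)
    show "vector_space s'" by (rule s')
  qed
  moreover have "F (prod_list (map \<iota> w)) = f w" for w
    using F[of "Poly_Mapping.single w 1"] by (simp add: word_eval_eq)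
  ultimately show ?thesis by blast
qed

end

subsection \<open>A Lie algebra embeds into its enveloping algebra\<close>

text \<open>Second component of the termination measure for straightening: swapping the letters of a
  descent keeps the length and lowers this number by one.\<close>

primrec inversions :: "('a \<Rightarrow> 'a \<Rightarrow> bool) \<Rightarrow> 'a list \<Rightarrow> nat" where
  "inversions lt [] = 0"
| "inversions lt (x # w) = length (filter (\<lambda>y. lt y x) w) + inversions lt w"

lemma inversions_swap:
  assumes "lt c b" "\<not> lt b c"
  shows "inversions lt (u @ b # c # v) = Suc (inversions lt (u @ c # b # v))"
  using assms by (induction u) auto

text \<open>With \<open>ext\<close> the linear extension from a basis, the slots are expanded one
  after another, so only the values of \<open>f\<close> on words in basis elements count.\<close>

primrec multi_ext ::
    "(('a \<Rightarrow> 'b) \<Rightarrow> 'a \<Rightarrow> 'b) \<Rightarrow> ('a list \<Rightarrow> 'b) \<Rightarrow> 'a list \<Rightarrow> 'b" where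
  "multi_ext ext f [] = f []"
| "multi_ext ext f (x # w) = ext (\<lambda>b. multi_ext ext (\<lambda>v. f (b # v)) w) x"

text \<open>\<open>ext f\<close> is the linear map that agrees with \<open>f\<close> on the basis
  \<open>B\<close>. The order compares all vectors, so words of arbitrary letters can be
  straightened without a side condition on membership in \<open>B\<close>.\<close>

locale basis_extension = lie_algebra scale bracket
  for scale :: "'k::field \<Rightarrow> 'g::ab_group_add \<Rightarrow> 'g" and bracket :: "'g \<Rightarrow> 'g \<Rightarrow> 'g" +
  fixes B :: "'g set"
    and lt :: "'g \<Rightarrow> 'g \<Rightarrow> bool"
    and ext :: "('g \<Rightarrow> 'g) \<Rightarrow> 'g \<Rightarrow> 'g"
  assumes linear_ext: "Vector_Spaces.linear scale scale (ext f)"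
    and ext_basis: "b \<in> B \<Longrightarrow> ext f b = f b"
    and linear_eqI: "Vector_Spaces.linear scale scale g \<Longrightarrow> Vector_Spaces.linear scale scale h \<Longrightarrow>
      (\<And>b. b \<in> B \<Longrightarrow> g b = h b) \<Longrightarrow> g x = h x"
    and lt_asym: "lt x y \<Longrightarrow> \<not> lt y x"
    and lt_trans: "lt x y \<Longrightarrow> lt y z \<Longrightarrow> lt x z"
    and lt_total: "x \<noteq> y \<Longrightarrow> lt x y \<or> lt y x"
begin

lemma ext_add: "ext f (x + y) = ext f x + ext f y"
  and ext_scale: "ext f (scale c x) = scale c (ext f x)"
  using linear_ext by (auto simp: Vector_Spaces.linear_iff)

lemma ext_zero [simp]: "ext f 0 = 0"
  using ext_scale[of f 0 0] by simp

lemma ext_minus: "ext f (- x) = - ext f x"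
  using ext_scale[of f "-1" x] by simp

lemma linearI:
  assumes "\<And>x y. g (x + y) = g x + g y" "\<And>c x. g (scale c x) = scale c (g x)"
  shows "Vector_Spaces.linear scale scale g"
  using assms vector_space_axioms by (auto simp: Vector_Spaces.linear_iff)

lemma ext_eqI:
  assumes "\<And>x y. g (x + y) = g x + g y" "\<And>c x. g (scale c x) = scale c (g x)"
    "\<And>b. b \<in> B \<Longrightarrow> f b = g b"
  shows "ext f x = g x"
  by (rule linear_eqI[OF linear_ext linearI]) (simp_all add: assms ext_basis)

lemma ext_ident: "ext (\<lambda>b. b) x = x"
  by (rule ext_eqI) auto

lemma ext_fun_add: "ext (\<lambda>b. f b + g b) x = ext f x + ext g x"
  by (rule ext_eqI) (auto simp: ext_add ext_scale ext_basis scale_right_distrib algebra_simps)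

lemma ext_fun_diff: "ext (\<lambda>b. f b - g b) x = ext f x - ext g x"
  by (rule ext_eqI) (auto simp: ext_add ext_scale ext_basis scale_right_diff_distrib algebra_simps)

lemma ext_fun_scale: "ext (\<lambda>b. scale c (f b)) x = scale c (ext f x)"
  by (rule ext_eqI) (auto simp: ext_add ext_scale ext_basis scale_right_distrib algebra_simps)

lemma ext_bracket: "ext (\<lambda>d. ext f (bracket d a)) x = ext f (bracket x a)"
  by (rule ext_eqI) (simp_all add: bracket_add bracket_scale ext_add ext_scale)

lemma ext_bracket': "ext (\<lambda>d. ext f (bracket a d)) x = ext f (bracket a x)"
  by (rule ext_eqI) (simp_all add: bracket_add bracket_scale ext_add ext_scale)

lemma ext_commute: "ext (\<lambda>d. ext (\<lambda>e. f d e) y) x = ext (\<lambda>e. ext (\<lambda>d. f d e) x) y"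
  by (rule ext_eqI) (auto simp: ext_add ext_scale ext_basis ext_fun_add ext_fun_scale)

section \<open>Straightening of words\<close>

definition descent :: "'g list \<Rightarrow> 'g list \<times> 'g \<times> 'g \<times> 'g list \<Rightarrow> bool" where
  "descent w t \<longleftrightarrow> (case t of (u, b, c, v) \<Rightarrow> w = u @ b # c # v \<and> lt c b)"

text \<open>
  The words are reduced by \<open>b c \<mapsto> c b + [b, c]\<close> at descents, with \<open>[b, c]\<close> expanded in the basis.
  The result does not depend on the choice of the descents by the diamond lemma: the ambiguity
  of \<open>a b c\<close> with \<open>c < b < a\<close> is resolved by the Jacobi identity.
\<close>

lemma descent_less:
  assumes "(u, b, c, v) = t" "descent w t"
  shows "length w = Suc (Suc (length u + length v)) \<and>
    inversions lt (u @ c # b # v) < inversions lt w"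
  using assms lt_asym by (auto simp: descent_def inversions_swap)

text \<open>Words without descents are the normal forms. Only those of length one are kept, so the
  value is the linear part of the normal form, which suffices to recover \<open>x\<close> from
  \<open>\<iota> x\<close>.\<close>

function sort_eval :: "'g list \<Rightarrow> 'g" where
  "sort_eval w =
    (if \<exists>t. descent w t
     then (case SOME t. descent w t of (u, b, c, v) \<Rightarrow>
        sort_eval (u @ c # b # v) + ext (\<lambda>d. sort_eval (u @ d # v)) (bracket b c))
     else (case w of [b] \<Rightarrow> b | _ \<Rightarrow> 0))"
  by pat_completeness auto
termination
  by (relation "measures [length, inversions lt]")
    (auto dest!: descent_less[OF _ someI])

declare sort_eval.simps [simp del]

definition reduct :: "'g list \<Rightarrow> 'g \<Rightarrow> 'g \<Rightarrow> 'g list \<Rightarrow> 'g" where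
  "reduct u b c v = sort_eval (u @ c # b # v) + ext (\<lambda>d. sort_eval (u @ d # v)) (bracket b c)"

text \<open>The choice operator picks some unknown descent; that any other would do is established
  in \<open>sort_eval_descent\<close>.\<close>

lemma sort_eval_some_descent:
  assumes "lt c b"
  shows "\<exists>u' b' c' v'. u @ b # c # v = u' @ b' # c' # v' \<and> lt c' b'
    \<and> sort_eval (u @ b # c # v) = reduct u' b' c' v'"
proof -
  let ?w = "u @ b # c # v"
  have ex: "\<exists>t. descent ?w t"
    using assms unfolding descent_def by blast
  obtain u' b' c' v' where t: "(SOME t. descent ?w t) = (u', b', c', v')"
    by (metis prod_cases4)
  have d: "descent ?w (u', b', c', v')"
    using someI_ex[OF ex] unfolding t .
  have "sort_eval ?w = reduct u' b' c' v'"
    using ex d by (subst sort_eval.simps) (simp add: t reduct_def)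
  then show ?thesis using d by (auto simp: descent_def)
qed

text \<open>Both sides are antisymmetric in the two letters, so it suffices to know the reduction in
  the order in which they form a descent.\<close>

lemma rel_from_descents:
  assumes "\<And>b c. lt c b \<Longrightarrow> (b, c) = (x, y) \<or> (b, c) = (y, x) \<Longrightarrow>
    sort_eval (u @ b # c # v) = reduct u b c v"
  shows "sort_eval (u @ x # y # v) - sort_eval (u @ y # x # v)
    = ext (\<lambda>d. sort_eval (u @ d # v)) (bracket x y)"
proof -
  consider "x = y" | "lt y x" | "lt x y" using lt_total by blast
  then show ?thesis
  proof cases
    case 1
    then show ?thesis by (simp add: bracket_self)
  next
    case 2
    then show ?thesis using assms[of y x] by (simp add: reduct_def)
  next
    case 3
    then show ?thesis
      using assms[of x y] bracket_antisym[of x y] by (simp add: reduct_def ext_minus)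
  qed
qed

text \<open>Descents without a common letter. \<open>H\<close> is the induction hypothesis for
  smaller words; it reduces each side at the other descent, and the results differ only in the order
  of the two basis expansions.\<close>

lemma reduct_disjoint:
  assumes H: "\<And>u b c v. lt c b \<Longrightarrow>
      (length (u @ b # c # v) < length w \<or> (length (u @ b # c # v) = length w \<and>
        inversions lt (u @ b # c # v) < inversions lt w)) \<Longrightarrow>
      sort_eval (u @ b # c # v) = reduct u b c v"
    and w: "w = u @ a # b # m @ c # d # v" and lt: "lt b a" "lt d c"
  shows "reduct u a b (m @ c # d # v) = reduct (u @ a # b # m) c d v"
proof -
  have inv: "inversions lt w = Suc (inversions lt (u @ b # a # m @ c # d # v))"
      "inversions lt w = Suc (inversions lt (u @ a # b # m @ d # c # v))"
    using inversions_swap[of lt b a u "m @ c # d # v"] lt lt_asym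
      inversions_swap[of lt d c "u @ a # b # m" v] by (auto simp: w)
  have 1: "sort_eval (u @ b # a # m @ c # d # v) = sort_eval (u @ b # a # m @ d # c # v)
      + ext (\<lambda>e. sort_eval (u @ b # a # m @ e # v)) (bracket c d)"
    using H[of d c "u @ b # a # m" v] inv lt by (simp add: w reduct_def)
  have 2: "sort_eval (u @ a # b # m @ d # c # v) = sort_eval (u @ b # a # m @ d # c # v)
      + ext (\<lambda>e. sort_eval (u @ e # m @ d # c # v)) (bracket a b)"
    using H[of b a u "m @ d # c # v"] inv lt by (simp add: w reduct_def)
  have 3: "sort_eval (u @ e # m @ c # d # v) = sort_eval (u @ e # m @ d # c # v)
      + ext (\<lambda>e'. sort_eval (u @ e # m @ e' # v)) (bracket c d)" for e
    using H[of d c "u @ e # m" v] lt by (simp add: w reduct_def)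
  have 4: "sort_eval (u @ a # b # m @ e # v) = sort_eval (u @ b # a # m @ e # v)
      + ext (\<lambda>e'. sort_eval (u @ e' # m @ e # v)) (bracket a b)" for e
    using H[of b a u "m @ e # v"] lt by (simp add: w reduct_def)
  show ?thesis
    by (simp add: reduct_def 1 2 3 4 ext_fun_add algebra_simps)
      (rule ext_commute)
qed

text \<open>Descents sharing the middle letter. Both sides are brought to the word with
  \<open>c, b, a\<close> in this order. The remaining terms are shorter words; moving their letters
  into a common order leaves double brackets that cancel by the Jacobi identity.\<close>

lemma reduct_overlap:
  assumes H: "\<And>u b c v. lt c b \<Longrightarrow>
      (length (u @ b # c # v) < length w \<or> (length (u @ b # c # v) = length w \<and>
        inversions lt (u @ b # c # v) < inversions lt w)) \<Longrightarrow>
      sort_eval (u @ b # c # v) = reduct u b c v"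
    and w: "w = u @ a # b # c # v" and lt: "lt b a" "lt c b"
  shows "reduct u a b (c # v) = reduct (u @ [a]) b c v"
proof -
  have lt': "lt c a" using lt lt_trans by blast
  have inv: "inversions lt w = Suc (inversions lt (u @ b # a # c # v))"
      "inversions lt (u @ b # a # c # v) = Suc (inversions lt (u @ b # c # a # v))"
      "inversions lt w = Suc (inversions lt (u @ a # c # b # v))"
      "inversions lt (u @ a # c # b # v) = Suc (inversions lt (u @ c # a # b # v))"
    using inversions_swap[of lt b a u "c # v"] inversions_swap[of lt c a "u @ [b]" v]
      inversions_swap[of lt c b "u @ [a]" v] inversions_swap[of lt c a u "b # v"]
      lt lt' lt_asym by (auto simp: w)
  let ?e = "\<lambda>d. sort_eval (u @ d # v)"
  \<comment> \<open>These words are shorter than \<open>w\<close>, so \<open>H\<close> gives the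
    relation for every pair of letters.\<close>
  have R: "sort_eval (u @ x # y # v) - sort_eval (u @ y # x # v) = ext ?e (bracket x y)" for x y
    by (rule rel_from_descents) (rule H, auto simp: w)
  have "sort_eval (u @ b # a # c # v) = sort_eval (u @ b # c # a # v)
      + ext (\<lambda>d. sort_eval (u @ b # d # v)) (bracket a c)"
    using H[of c a "u @ [b]" v] inv lt' by (simp add: w reduct_def)
  moreover have "sort_eval (u @ b # c # a # v) = sort_eval (u @ c # b # a # v)
      + ext (\<lambda>d. sort_eval (u @ d # a # v)) (bracket b c)"
    using H[of c b u "a # v"] inv lt by (simp add: w reduct_def)
  moreover have "sort_eval (u @ a # c # b # v) = sort_eval (u @ c # a # b # v)
      + ext (\<lambda>d. sort_eval (u @ d # b # v)) (bracket a c)"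
    using H[of c a u "b # v"] inv lt' by (simp add: w reduct_def)
  moreover have "sort_eval (u @ c # a # b # v) = sort_eval (u @ c # b # a # v)
      + ext (\<lambda>d. sort_eval (u @ c # d # v)) (bracket a b)"
    using H[of b a "u @ [c]" v] inv lt by (simp add: w reduct_def)
  moreover have "ext (\<lambda>d. sort_eval (u @ d # z # v)) x - ext (\<lambda>d. sort_eval (u @ z # d # v)) x
      = ext ?e (bracket x z)" for x z
    by (simp add: ext_fun_diff[symmetric] R ext_bracket)
  then have "ext (\<lambda>d. sort_eval (u @ d # z # v)) x
      = ext (\<lambda>d. sort_eval (u @ z # d # v)) x + ext ?e (bracket x z)" for x z
    by (simp add: diff_eq_eq add.commute)
  moreover have "ext ?e (bracket (bracket b c) a) + ext ?e (bracket (bracket a b) c)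
      = ext ?e (bracket (bracket a c) b)"
  proof -
    have "bracket (bracket a c) b = - bracket b (bracket a c)"
      by (rule bracket_antisym)
    moreover have "bracket b (bracket a c) = bracket (bracket b a) c + bracket a (bracket b c)"
      by (rule bracket_bracket)
    moreover have "bracket b a = - bracket a b" "bracket (bracket b c) a = - bracket a (bracket b c)"
      by (rule bracket_antisym)+
    ultimately have "bracket (bracket b c) a + bracket (bracket a b) c = bracket (bracket a c) b"
      by (simp add: bracket_minus)
    then show ?thesis by (simp add: ext_add[symmetric])
  qed
  ultimately show ?thesis
    by (simp add: reduct_def algebra_simps)
qed

text \<open>Confluence by induction on length and inversions: the given descent and the chosen one
  coincide, overlap or are disjoint.\<close>

lemma sort_eval_descent:
  assumes "lt c b"
  shows "sort_eval (u @ b # c # v) = reduct u b c v"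
  using assms
proof (induction "u @ b # c # v" arbitrary: u b c v
    rule: wf_induct_rule[OF wf_measures[of "[length, inversions lt]"]])
  case (1 u b c v)
  define w where "w = u @ b # c # v"
  have H: "sort_eval (u @ b # c # v) = reduct u b c v"
    if "lt c b" "length (u @ b # c # v) < length w \<or> (length (u @ b # c # v) = length w \<and>
        inversions lt (u @ b # c # v) < inversions lt w)" for u b c v
    using 1(1)[OF _ that(1)] that(2) unfolding w_def by auto
  \<comment> \<open>By symmetry one descent may be assumed to start further left; \<open>m\<close>
    is the stretch between the two starting points.\<close>
  have less: "reduct u b c v = reduct u' b' c' v'"
    if w: "w = u @ b # c # v" "w = u' @ b' # c' # v'" and lt: "lt c b" "lt c' b'"
      and len: "length u < length u'"
    for u b c v u' b' c' v'
  proof -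
    obtain m where m: "u' = u @ m" "b # c # v = m @ b' # c' # v'"
      using w len by (auto simp: append_eq_append_conv2)
    have "m \<noteq> []" using len m by auto
    then consider "m = [b]" | m' where "m = b # c # m'"
      using m(2) by (cases m; cases "tl m") auto
    then show ?thesis
    proof cases
      case 1
      have "reduct u b c (c' # v') = reduct (u @ [b]) c c' v'"
        by (rule reduct_overlap[of w], erule (1) H) (use 1 m w(1) lt in auto)
      then show ?thesis using 1 m by simp
    next
      case (2 m')
      have "reduct u b c (m' @ b' # c' # v') = reduct (u @ b # c # m') b' c' v'"
        by (rule reduct_disjoint[of w], erule (1) H) (use 2 m w(1) lt in auto)
      then show ?thesis using 2 m by simp
    qed
  qed
  obtain u' b' c' v' where w': "w = u' @ b' # c' # v'" "lt c' b'" "sort_eval w = reduct u' b' c' v'"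
    using sort_eval_some_descent[OF 1(2), of u v] unfolding w_def by blast
  consider "length u < length u'" | "length u' < length u" | "length u = length u'" by linarith
  then show ?case
  proof cases
    case 1
    with less[of u b c v u' b' c' v'] w' \<open>lt c b\<close> show ?thesis by (simp add: w_def)
  next
    case 2
    with less[of u' b' c' v' u b c v] w' \<open>lt c b\<close> show ?thesis by (simp add: w_def)
  next
    case 3
    with w' show ?thesis by (simp add: w_def)
  qed
qed

lemma sort_eval_rel:
  "sort_eval (u @ x # y # v) - sort_eval (u @ y # x # v)
    = ext (\<lambda>d. sort_eval (u @ d # v)) (bracket x y)"
  by (rule rel_from_descents) (rule sort_eval_descent)

lemma sort_eval_singleton: "sort_eval [b] = b"
  by (subst sort_eval.simps) (auto simp: descent_def)

section \<open>Multilinear extension from letters to vectors\<close>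

lemma multi_ext_diff:
  "multi_ext ext (\<lambda>v. f v - g v) w = multi_ext ext f w - multi_ext ext g w"
  by (induction w arbitrary: f g) (auto simp: ext_fun_diff)

lemma multi_ext_ext:
  "multi_ext ext (\<lambda>v. ext (\<lambda>d. g d v) z) w = ext (\<lambda>d. multi_ext ext (g d) w) z"
proof (induction w arbitrary: g)
  case (Cons x w)
  then show ?case by (simp add: ext_commute[of _ x])
qed simp

lemma multilinear_multi_ext: "multilinear scale scale n (multi_ext ext f)"
proof (induction n arbitrary: f)
  case 0
  show ?case by (rule multilinear_0)
next
  case (Suc n)
  show ?case
  proof (rule multilinear_SucI)
    show "multilinear scale scale n (\<lambda>v. multi_ext ext f (a # v))" for a
      using multilinearD[OF Suc] unfolding multilinear_def
      by (simp add: ext_fun_add ext_fun_scale)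
  qed (simp_all add: ext_add ext_scale)
qed

text \<open>The hypothesis concerns letters, with their bracket expanded by \<open>ext\<close>. In
  the extension \<open>x\<close> and \<open>y\<close> are expanded too, and bilinearity of the
  bracket merges the three expansions into one of \<open>bracket x y\<close>.\<close>

lemma multi_ext_rel:
  assumes "\<And>u x y v. f (u @ x # y # v) - f (u @ y # x # v) = ext (\<lambda>d. f (u @ d # v)) (bracket x y)"
  shows "multi_ext ext f (u @ x # y # v) - multi_ext ext f (u @ y # x # v)
    = multi_ext ext f (u @ bracket x y # v)"
  using assms
proof (induction u arbitrary: f)
  case Nil
  have "multi_ext ext f (x # y # v) - multi_ext ext f (y # x # v)
      = ext (\<lambda>b. ext (\<lambda>c. multi_ext ext (\<lambda>v. f (b # c # v)) v) y) x
        - ext (\<lambda>b. ext (\<lambda>c. multi_ext ext (\<lambda>v. f (c # b # v)) v) y) x"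
    by (simp add: ext_commute[of _ x y])
  also have "\<dots> = ext (\<lambda>b. ext (\<lambda>c. multi_ext ext (\<lambda>v. f (b # c # v) - f (c # b # v)) v) y) x"
    by (simp add: ext_fun_diff multi_ext_diff)
  also have "\<dots> = ext (\<lambda>b. ext (\<lambda>c. multi_ext ext (\<lambda>v. ext (\<lambda>d. f (d # v)) (bracket b c)) v) y) x"
    using Nil[of "[]"] by simp
  also have "\<dots> = ext (\<lambda>d. multi_ext ext (\<lambda>v. f (d # v)) v) (bracket x y)"
    by (simp add: multi_ext_ext ext_bracket ext_bracket')
  finally show ?case by simp
next
  case (Cons a u)
  have "multi_ext ext (\<lambda>v. f (b # v)) (u @ x # y # v) - multi_ext ext (\<lambda>v. f (b # v)) (u @ y # x # v)
    = multi_ext ext (\<lambda>v. f (b # v)) (u @ bracket x y # v)" for b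
    using Cons.prems[of "b # w" for w] by (intro Cons.IH) simp
  then show ?case by (simp add: ext_fun_diff[symmetric])
qed

end

lemma (in lie_algebra) ex_basis_extension:
  "\<exists>B lt ext. basis_extension scale bracket B lt ext"
proof -
  interpret vs: vector_space_pair scale scale by unfold_locales
  obtain B where B: "independent B" "span B = UNIV"
    using maximal_independent_subset[of UNIV] by (metis UNIV_I subsetI subset_antisym)
  obtain r :: "'g rel" where r: "well_order_on UNIV r"
    using well_order_on by blast
  then have r: "total r" "antisym r" "trans r"
    by (auto simp: order_on_defs)
  have "basis_extension scale bracket B (\<lambda>x y. (x, y) \<in> r \<and> x \<noteq> y) (vs.construct B)"
  proof (intro basis_extension.intro basis_extension_axioms.intro lie_algebra_axioms)
    show "Vector_Spaces.linear scale scale (vs.construct B f)" for f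
      by (rule vs.linear_construct) fact
    show "vs.construct B f b = f b" if "b \<in> B" for f b
      using B(1) that by (rule vs.construct_basis)
    show "g x = h x" if "Vector_Spaces.linear scale scale g" "Vector_Spaces.linear scale scale h"
      "\<And>b. b \<in> B \<Longrightarrow> g b = h b" for g h x
      using vs.linear_eq_on[OF that(1,2), of x B] B(2) that(3) by simp
  qed (use r in \<open>auto simp: total_on_def antisym_def trans_def\<close>)
  then show ?thesis by blast
qed

text \<open>The linear map on the enveloping algebra induced by \<open>sort_eval\<close> is a left
  inverse of \<open>\<iota>\<close>, since single letters are normal forms.\<close>

lemma (in universal_enveloping_algebra) inj_\<iota>: "inj \<iota>"
proof -
  obtain B lt ext where "basis_extension scale bracket B lt ext"
    using ex_basis_extension by blast
  then interpret basis_extension scale bracket B lt ext .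
  obtain F where F: "\<And>w. F (prod_list (map \<iota> w)) = multi_ext ext sort_eval w"
    using linear_map_of_word_function[OF vector_space_axioms multilinear_multi_ext
        multi_ext_rel[OF sort_eval_rel]] by blast
  have "F (\<iota> x) = x" for x
    using F[of "[x]"] by (simp add: sort_eval_singleton ext_ident)
  then show ?thesis by (rule inj_on_inverseI)
qed

subsection \<open>Sweedler sums\<close>

lemma bilinearI:
  assumes "\<And>x x' y. f (x + x') y = f x y + f x' y" "\<And>x y y'. f x (y + y') = f x y + f x y'"
    "\<And>c x y. f (s c x) y = s' c (f x y)" "\<And>c x y. f x (s c y) = s' c (f x y)"
  shows "bilinear s s' f"
  using assms by (simp add: bilinear_def)

lemma bilinearD:
  assumes "bilinear s s' f"
  shows "f (x + x') y = f x y + f x' y" "f x (y + y') = f x y + f x y'"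
    "f (s c x) y = s' c (f x y)" "f x (s c y) = s' c (f x y)"
  using assms by (simp_all add: bilinear_def)

lemma trilinearI:
  assumes "\<And>z. bilinear s s' (\<lambda>x y. f x y z)" "\<And>x. bilinear s s' (f x)"
  shows "trilinear s s' f"
  using assms by (simp add: trilinear_def bilinear_def)

context coalgebra
begin

definition sweedler :: "('a \<Rightarrow> 'a \<Rightarrow> 'c::comm_monoid_add) \<Rightarrow> 'a \<Rightarrow> 'c" where
  "sweedler f x = (\<Sum>(a, b)\<in>#\<Delta> x. f a b)"

lemma sweedler_fun_add: "sweedler (\<lambda>a b. f a b + g a b) x = sweedler f x + sweedler g x"
  by (simp add: sweedler_def case_prod_unfold sum_mset.distrib)

lemma sweedler_additive:
  fixes h :: "'c::ab_group_add \<Rightarrow> 'd::ab_group_add"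
  assumes "\<And>x y. h (x + y) = h x + h y"
  shows "sweedler (\<lambda>a b. h (f a b)) x = h (sweedler f x)"
proof -
  have "h 0 = 0" using assms[of 0 0] by simp
  then have "(\<Sum>(a, b)\<in>#M. h (f a b)) = h (\<Sum>(a, b)\<in>#M. f a b)" for M
    by (induction M) (auto simp: assms)
  then show ?thesis by (simp add: sweedler_def)
qed

lemma sweedler_fun_diff:
  fixes f :: "'a \<Rightarrow> 'a \<Rightarrow> 'c::ab_group_add"
  shows "sweedler (\<lambda>a b. f a b - g a b) x = sweedler f x - sweedler g x"
  using sweedler_fun_add[of "\<lambda>a b. f a b - g a b" g x] by simp

lemma sweedler_swap:
  "sweedler (\<lambda>a b. sweedler (\<lambda>c d. f a b c d) y) x = sweedler (\<lambda>c d. sweedler (\<lambda>a b. f a b c d) x) y"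
  unfolding sweedler_def case_prod_unfold by (rule sum_mset.swap)

context
  fixes s' :: "'k \<Rightarrow> 'c::ab_group_add \<Rightarrow> 'c"
  assumes s': "vector_space s'"
begin

lemma sweedler_fun_scale: "sweedler (\<lambda>a b. s' c (f a b)) x = s' c (sweedler f x)"
proof -
  interpret T: vector_space s' by (rule s')
  show ?thesis by (rule sweedler_additive) (rule T.scale_right_distrib)
qed

lemma sweedler_same_tensor2:
  assumes "same_tensor2 scale (\<Delta> x) M" "bilinear scale s' f"
  shows "sweedler f x = (\<Sum>(a, b)\<in>#M. f a b)"
  unfolding sweedler_def by (rule sum_eq_if_same_tensor2[OF s' assms])

lemma sweedler_add:
  assumes "bilinear scale s' f"
  shows "sweedler f (x + y) = sweedler f x + sweedler f y"
  using sweedler_same_tensor2[OF comult_add assms] by (simp add: sweedler_def)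

lemma sweedler_scale:
  assumes "bilinear scale s' f"
  shows "sweedler f (scale c x) = s' c (sweedler f x)"
proof -
  have "sweedler f (scale c x) = sweedler (\<lambda>a b. f (scale c a) b) x"
    using sweedler_same_tensor2[OF comult_scale assms]
    by (simp add: sweedler_def multiset.map_comp comp_def case_prod_unfold)
  then show ?thesis
    by (simp add: bilinearD[OF assms] sweedler_fun_scale)
qed

lemma linear_sweedler:
  assumes "bilinear scale s' f"
  shows "Vector_Spaces.linear scale s' (sweedler f)"
  using s' vector_space_axioms sweedler_add[OF assms] sweedler_scale[OF assms]
  by (simp add: Vector_Spaces.linear_iff)

lemma sweedler_coassoc:
  assumes "trilinear scale s' t"
  shows "sweedler (\<lambda>a b. sweedler (\<lambda>c d. t c d b) a) x = sweedler (\<lambda>a b. sweedler (\<lambda>c d. t a c d) b) x"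
  using sum_eq_if_same_tensor3[OF s' coassoc[unfolded case_prod_unfold] assms]
  by (simp add: sweedler_def case_prod_unfold)

end

lemma sweedler_counit: "sweedler (\<lambda>a b. scale (\<epsilon> a) b) x = x" "sweedler (\<lambda>a b. scale (\<epsilon> b) a) x = x"
  unfolding sweedler_def by (rule counit_left counit_right)+

text \<open>Testing on scalar bilinear forms replaces equality of tensors by equations between
  scalars, which can be proved by induction over the algebra.\<close>

lemma coalgebra_map_iff:
  "coalgebra_map scale \<Delta> \<epsilon> B \<longleftrightarrow> Vector_Spaces.linear scale scale B \<and>
    (\<forall>x \<beta>. bilinear scale (*) \<beta> \<longrightarrow> sweedler \<beta> (B x) = sweedler (\<lambda>a b. \<beta> (B a) (B b)) x) \<and>
    (\<forall>x. \<epsilon> (B x) = \<epsilon> x)"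
  unfolding coalgebra_map_def same_tensor2_iff[OF vector_space_axioms]
  by (simp add: sweedler_def multiset.map_comp comp_def case_prod_unfold)

lemma sweedler_coalgebra_map:
  assumes "coalgebra_map scale \<Delta> \<epsilon> B" "vector_space s'" "bilinear scale s' f"
  shows "sweedler f (B x) = sweedler (\<lambda>a b. f (B a) (B b)) x"
proof -
  have "same_tensor2 scale (\<Delta> (B x)) (image_mset (\<lambda>(a, b). (B a, B b)) (\<Delta> x))"
    using assms(1) by (simp add: coalgebra_map_def)
  from sweedler_same_tensor2[OF assms(2) this assms(3)] show ?thesis
    by (simp add: sweedler_def multiset.map_comp comp_def case_prod_unfold)
qed

lemma counit_add: "\<epsilon> (x + y) = \<epsilon> x + \<epsilon> y"
  and counit_scale: "\<epsilon> (scale c x) = c * \<epsilon> x"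
  using linear_counit by (simp_all add: Vector_Spaces.linear_iff)

end

section \<open>Bialgebras and primitive elements\<close>

context bialgebra
begin

lemmas scale_mult = scale_mult_left scale_mult_right

lemma sweedler_mult:
  assumes "vector_space s'" "bilinear scale s' f"
  shows "sweedler f (x * y) = sweedler (\<lambda>a b. sweedler (\<lambda>c d. f (a * c) (b * d)) y) x"
proof -
  have "(\<Sum>(a, b)\<in>#(\<Sum>p\<in>#M. image_mset (\<lambda>q. (fst p * fst q, snd p * snd q)) N). f a b)
    = (\<Sum>p\<in>#M. \<Sum>q\<in>#N. f (fst p * fst q) (snd p * snd q))" for M N
    by (induction M) (auto simp: multiset.map_comp comp_def)
  with sweedler_same_tensor2[OF assms(1) comult_mult assms(2), of x y] show ?thesis
    by (simp add: sweedler_def case_prod_unfold)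
qed

lemma sweedler_one:
  assumes "vector_space s'" "bilinear scale s' f"
  shows "sweedler f 1 = f 1 1"
  using sweedler_same_tensor2[OF assms(1) comult_one assms(2)] by simp

definition primitive :: "'a \<Rightarrow> bool" where
  "primitive p \<longleftrightarrow> same_tensor2 scale (\<Delta> p) {#(p, 1), (1, p)#}"

lemma sweedler_primitive:
  assumes "primitive p" "vector_space s'" "bilinear scale s' f"
  shows "sweedler f p = f p 1 + f 1 p"
  using sweedler_same_tensor2[OF assms(2) assms(1)[unfolded primitive_def] assms(3)] by simp

lemma primitive_iff:
  "primitive p \<longleftrightarrow> (\<forall>\<beta>. bilinear scale (*) \<beta> \<longrightarrow> sweedler \<beta> p = \<beta> p 1 + \<beta> 1 p)"
  unfolding primitive_def same_tensor2_iff[OF vector_space_axioms] by (simp add: sweedler_def)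

lemma bilinear_sweedler_mult:
  assumes s': "vector_space s'" and f: "bilinear scale s' f"
  shows "bilinear scale s' (\<lambda>a b. sweedler (\<lambda>c d. f (a * c) (b * d)) u)"
    "bilinear scale s' (\<lambda>a b. sweedler (\<lambda>c d. f (c * a) (d * b)) u)"
  by (rule bilinearI; simp add: bilinearD[OF f] distrib_left distrib_right scale_mult
      sweedler_fun_add sweedler_fun_scale[OF s'])+

text \<open>Comultiplication is multiplicative and that of \<open>p\<close> has just two terms, so
  multiplication by \<open>p\<close> on either side is a coderivation.\<close>

lemma sweedler_primitive_mult:
  assumes p: "primitive p" and s': "vector_space s'" and f: "bilinear scale s' f"
  shows "sweedler f (p * u) = sweedler (\<lambda>a b. f (p * a) b + f a (p * b)) u"
    "sweedler f (u * p) = sweedler (\<lambda>a b. f (a * p) b + f a (b * p)) u"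
proof -
  show "sweedler f (p * u) = sweedler (\<lambda>a b. f (p * a) b + f a (p * b)) u"
    unfolding sweedler_mult[OF s' f] sweedler_fun_add
    by (subst sweedler_primitive[OF p s' bilinear_sweedler_mult(1)[OF s' f]]) simp
  show "sweedler f (u * p) = sweedler (\<lambda>a b. f (a * p) b + f a (b * p)) u"
    unfolding sweedler_mult[OF s' f] sweedler_fun_add
    by (subst sweedler_swap, subst sweedler_primitive[OF p s' bilinear_sweedler_mult(2)[OF s' f]]) simp
qed

text \<open>Applying \<open>\<epsilon>\<close> to the first factor of the comultiplication of
  \<open>p\<close> yields \<open>p\<close>, but also
  \<open>scale (\<epsilon> p) 1 + p\<close>.\<close>

lemma counit_primitive:
  assumes "primitive p"
  shows "\<epsilon> p = 0"
proof -
  have "bilinear scale scale (\<lambda>a b. scale (\<epsilon> a) b)"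
    by (rule bilinearI)
      (simp_all add: counit_add counit_scale scale_left_distrib scale_right_distrib scale_left_commute)
  from sweedler_primitive[OF assms vector_space_axioms this]
  have "scale (\<epsilon> p) 1 = 0" by (simp add: sweedler_counit counit_one)
  moreover have "(1 :: 'a) \<noteq> 0"
  proof
    assume "(1 :: 'a) = 0"
    then have "\<epsilon> (1 :: 'a) = \<epsilon> (scale 0 1)" by simp
    also have "\<dots> = 0" unfolding counit_scale by simp
    finally show False using counit_one by simp
  qed
  ultimately show ?thesis by simp
qed

end

section \<open>The antipode on primitive elements\<close>

context hopf_algebra
begin

lemma antipode_add: "S (x + y) = S x + S y"
  and antipode_scale: "S (scale c x) = scale c (S x)"
  using linear_antipode by (simp_all add: Vector_Spaces.linear_iff)

lemma sweedler_antipode: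
  "sweedler (\<lambda>a b. S a * b) x = scale (\<epsilon> x) 1" "sweedler (\<lambda>a b. a * S b) x = scale (\<epsilon> x) 1"
  unfolding sweedler_def by (rule antipode_left antipode_right)+

lemma antipode_one: "S 1 = 1"
proof -
  have "bilinear scale scale (\<lambda>a b. S a * b)"
    by (rule bilinearI)
      (simp_all add: antipode_add antipode_scale scale_mult distrib_left distrib_right)
  from sweedler_one[OF vector_space_axioms this] show ?thesis
    by (simp add: sweedler_antipode counit_one)
qed

text \<open>The function \<open>f\<close> below vanishes because its convolution with the identity does.\<close>

lemma antipode_primitive_mult:
  assumes p: "primitive p"
  shows "S (p * u) = - S u * p"
proof -
  define f where "f u = S (p * u) + S u * p" for u
  have f: "f (x + y) = f x + f y" "f (scale c x) = scale c (f x)" for x y c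
    by (simp_all add: f_def antipode_add antipode_scale scale_mult distrib_left distrib_right
        scale_right_distrib)
  have "bilinear scale scale (\<lambda>a b. S a * b)"
    by (rule bilinearI)
      (simp_all add: antipode_add antipode_scale scale_mult distrib_left distrib_right)
  from sweedler_primitive_mult(1)[OF p vector_space_axioms this]
  have "sweedler (\<lambda>a b. f a * b) u = sweedler (\<lambda>a b. S a * b) (p * u)" for u
    by (simp add: f_def distrib_right mult.assoc)
  then have conv: "sweedler (\<lambda>a b. f a * b) u = 0" for u
    by (simp add: sweedler_antipode counit_mult counit_primitive[OF p])
  \<comment> \<open>The convolution of the identity with \<open>S\<close> is the convolution unit,
    so it may be inserted behind \<open>f\<close>; coassociativity regroups the factors until
    \<open>conv\<close> applies.\<close>
  have "f u = f (sweedler (\<lambda>a b. scale (\<epsilon> b) a) u)" by (simp add: sweedler_counit)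
  also have "\<dots> = sweedler (\<lambda>a b. f (scale (\<epsilon> b) a)) u"
    by (rule sweedler_additive[symmetric]) (rule f)
  also have "\<dots> = sweedler (\<lambda>a b. f a * sweedler (\<lambda>c d. c * S d) b) u"
    by (simp add: f sweedler_antipode scale_mult)
  also have "\<dots> = sweedler (\<lambda>a b. sweedler (\<lambda>c d. f a * (c * S d)) b) u"
    by (subst sweedler_additive) (simp_all add: distrib_left)
  also have "\<dots> = sweedler (\<lambda>a b. sweedler (\<lambda>c d. f c * (d * S b)) a) u"
    by (rule sweedler_coassoc[OF vector_space_axioms, symmetric], intro trilinearI bilinearI)
      (simp_all add: f antipode_add antipode_scale scale_mult distrib_left distrib_right)
  also have "\<dots> = sweedler (\<lambda>a b. sweedler (\<lambda>c d. f c * d) a * S b) u"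
    by (subst sweedler_additive[of "\<lambda>x. x * S b" for b, symmetric])
      (simp_all add: distrib_right mult.assoc)
  also have "\<dots> = 0" by (simp add: conv sweedler_def case_prod_unfold)
  finally show ?thesis by (simp add: f_def eq_neg_iff_add_eq_0)
qed

lemma antipode_primitive: "primitive p \<Longrightarrow> S p = - p"
  using antipode_primitive_mult[of p 1] by (simp add: antipode_one)

end

subsection \<open>Primitive elements of an enveloping algebra\<close>

context universal_enveloping_algebra
begin

abbreviation word :: "'g list \<Rightarrow> 'u" where
  "word w \<equiv> prod_list (map \<iota> w)"

text \<open>The length filtration. The strict bound makes stage 0 the zero space, so inductions over
  the stages start trivially.\<close>

definition words_below :: "nat \<Rightarrow> 'u set" where
  "words_below n = U.span (word ` {w. length w < n})"

lemma word_in_words_below: "length w < n \<Longrightarrow> word w \<in> words_below n"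
  unfolding words_below_def by (intro U.span_base) auto

lemma subspace_words_below: "U.subspace (words_below n)"
  unfolding words_below_def by (rule U.subspace_span)

lemma words_below_mono: "m \<le> n \<Longrightarrow> words_below m \<subseteq> words_below n"
  unfolding words_below_def by (intro U.span_mono) auto

lemma words_below_image:
  assumes y: "y \<in> words_below n"
    and h: "\<And>x y. h (x + y) = h x + h y" "\<And>c x. h (scaleU c x) = scaleU c (h x)"
    and V: "U.subspace V" "\<And>w. length w < n \<Longrightarrow> h (word w) \<in> V"
  shows "h y \<in> V"
proof -
  have "h 0 = 0" using h(1)[of 0 0] by simp
  show ?thesis
    using y unfolding words_below_def
  proof (induction rule: U.span_induct_alt)
    case base
    then show ?case using \<open>h 0 = 0\<close> V(1) by (simp add: U.subspace_0)
  next
    case (step c x y)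
    then show ?case using V by (auto simp: h intro!: U.subspace_add U.subspace_scale)
  qed
qed

lemma words_below_cover: "\<exists>n. u \<in> words_below n"
proof -
  have "u \<in> U.span (range word)" using span_words by simp
  then show ?thesis
  proof (induction rule: U.span_induct_alt)
    case base
    then show ?case using subspace_words_below U.subspace_0 by blast
  next
    case (step c x y)
    then obtain w n where w: "x = word w" "y \<in> words_below n" by auto
    let ?m = "max n (Suc (length w))"
    have "scaleU c x + y \<in> words_below ?m"
      using w words_below_mono[of n ?m] word_in_words_below[of w ?m]
      by (intro U.subspace_add U.subspace_scale subspace_words_below) auto
    then show ?case by blast
  qed
qed

lemma \<iota>_mult_words_below: "y \<in> words_below n \<Longrightarrow> \<iota> x * y \<in> words_below (Suc n)"
  using word_in_words_below[of "x # w" for w]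
  by (elim words_below_image) (auto simp: distrib_left U.scale_mult_right subspace_words_below)

lemma words_below_mult_word: "y \<in> words_below n \<Longrightarrow> y * word v \<in> words_below (n + length v)"
  using word_in_words_below[of "w @ v" for w]
  by (elim words_below_image) (auto simp: distrib_right U.scale_mult_left subspace_words_below)

text \<open>Commuting with \<open>\<iota> z\<close> is a derivation that replaces one letter at a
  time by its bracket with \<open>z\<close>, so words do not get longer.\<close>

lemma commutator_word: "\<iota> z * word w - word w * \<iota> z \<in> words_below (Suc (length w))"
proof (induction w)
  case Nil
  then show ?case by (simp add: subspace_words_below U.subspace_0)
next
  case (Cons x w)
  have "\<iota> z * word (x # w) - word (x # w) * \<iota> z
      = word (bracket z x # w) + \<iota> x * (\<iota> z * word w - word w * \<iota> z)"
    by (simp add: \<iota>_bracket algebra_simps)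
  also have "\<dots> \<in> words_below (Suc (length (x # w)))"
    using word_in_words_below[of "bracket z x # w"] \<iota>_mult_words_below[OF Cons]
    by (intro U.subspace_add subspace_words_below) auto
  finally show ?case .
qed

text \<open>Applied to the tail of a word, the twisted operator of its first letter gives the word
  plus a commutator that is no longer than the tail. That commutator lies in the stage already
  covered and can be subtracted.\<close>

lemma twisted_induct:
  assumes add: "\<And>u v. P u \<Longrightarrow> P v \<Longrightarrow> P (u + v)" and scale: "\<And>c u. P u \<Longrightarrow> P (scaleU c u)"
    and one: "P 1"
    and step: "\<And>x u. P u \<Longrightarrow> P (\<iota> x * u + (\<iota> (R x) * u - u * \<iota> (R x)))"
  shows "P u"
proof -
  have "P 0" using scale[OF one, of 0] by simp
  then have V: "U.subspace {u. P u}"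
    using add scale by (intro U.subspaceI) auto
  have "words_below n \<subseteq> {u. P u}" for n
  proof (induction n)
    case 0
    then show ?case using \<open>P 0\<close> by (simp add: words_below_def)
  next
    case (Suc n)
    have "P (word w)" if w: "length w < Suc n" for w
    proof (cases w)
      case (Cons x v)
      let ?c = "\<iota> (R x) * word v - word v * \<iota> (R x)"
      have *: "P (\<iota> x * word v + ?c)"
        using w Cons Suc word_in_words_below[of v n] by (intro step) auto
      have "P ?c"
        using commutator_word[of "R x" v] words_below_mono[of "Suc (length v)" n] w Cons Suc by auto
      then have "P ((\<iota> x * word v + ?c) + scaleU (-1) ?c)"
        by (rule add[OF * scale])
      moreover have "(\<iota> x * word v + ?c) + scaleU (-1) ?c = word w"
        unfolding U.scale_minus_left U.scale_one by (simp add: Cons)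
      ultimately show ?thesis by (simp only:)
    qed (simp add: one)
    then show ?case
      using words_below_image[of _ "Suc n" "\<lambda>x. x", OF _ _ _ V] by blast
  qed
  then show ?thesis using words_below_cover by blast
qed

end

section \<open>Comultiplication of words\<close>

context enveloping_hopf_algebra
begin

lemma primitive_\<iota>: "U.primitive (\<iota> x)"
  unfolding U.primitive_def by (rule primitive)

text \<open>Each letter, being primitive, goes to one of the two factors, so the length of the word
  is split between them. The induction absorbs the letters into \<open>f\<close>.\<close>

lemma sweedler_word_in:
  assumes V: "U.subspace V" and f: "bilinear scaleU scaleU f"
    and "\<And>a b. length a + length b = length w \<Longrightarrow> f (word a) (word b) \<in> V"
  shows "U.sweedler f (word w) \<in> V"
  using f assms(3)
proof (induction w arbitrary: f)
  case Nil
  then show ?case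
    using Nil(2)[of "[]" "[]"] by (simp add: U.sweedler_one[OF U.vector_space_axioms])
next
  case (Cons x w)
  note f = bilinearD[OF Cons.prems(1)]
  have "U.sweedler (\<lambda>a b. f (\<iota> x * a) b + f a (\<iota> x * b)) (word w) \<in> V"
  proof (rule Cons.IH)
    show "bilinear scaleU scaleU (\<lambda>a b. f (\<iota> x * a) b + f a (\<iota> x * b))"
      by (rule bilinearI)
        (simp_all add: f distrib_left U.scale_mult_right U.scale_right_distrib algebra_simps)
    show "f (\<iota> x * word a) (word b) + f (word a) (\<iota> x * word b) \<in> V"
      if "length a + length b = length w" for a b
      using Cons.prems(2)[of "x # a" b] Cons.prems(2)[of a "x # b"] that V
      by (simp add: U.subspace_add)
  qed
  then show ?case
    by (simp add: U.sweedler_primitive_mult[OF primitive_\<iota> U.vector_space_axioms Cons.prems(1)])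
qed

lemma bilinear_mult: "bilinear scaleU scaleU (*)"
  by (rule bilinearI) (simp_all add: algebra_simps U.scale_mult)

text \<open>The letters are distributed over two factors in \<open>2 ^ length w\<close> ways;
  restoring their order in the product costs commutators, which are shorter.\<close>

lemma sweedler_mult_word:
  "U.sweedler (*) (word w) - scaleU (2 ^ length w) (word w) \<in> words_below (length w)"
proof (induction w)
  case Nil
  then show ?case
    by (simp add: U.sweedler_one[OF U.vector_space_axioms bilinear_mult]
        subspace_words_below U.subspace_0)
next
  case (Cons x w)
  let ?m = "U.sweedler (*) (word w)" and ?n = "length w"
  \<comment> \<open>The cost of moving the letter \<open>x\<close> from the second factor past
    \<open>a\<close> to the front.\<close>
  define f where "f a b = (\<iota> x * a - a * \<iota> x) * b" for a b
  have f: "bilinear scaleU scaleU f"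
    unfolding f_def by (rule bilinearI) (simp_all add: algebra_simps U.scale_mult)
  have "U.sweedler f (word w) \<in> words_below (Suc ?n)"
  proof (rule sweedler_word_in[OF subspace_words_below f])
    fix a b :: "'g list"
    assume "length a + length b = length w"
    with words_below_mult_word[OF commutator_word[of x a], of b]
    show "f (word a) (word b) \<in> words_below (Suc ?n)" by (simp add: f_def)
  qed
  moreover have "\<iota> x * (?m - scaleU (2 ^ ?n) (word w)) \<in> words_below (Suc ?n)"
    by (rule \<iota>_mult_words_below) (rule Cons)
  ultimately have "scaleU 2 (\<iota> x * (?m - scaleU (2 ^ ?n) (word w))) - U.sweedler f (word w)
      \<in> words_below (Suc ?n)"
    by (intro U.subspace_diff U.subspace_scale subspace_words_below)
  moreover have "U.sweedler (*) (word (x # w)) = scaleU 2 (\<iota> x * ?m) - U.sweedler f (word w)"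
  proof -
    have "U.sweedler (*) (word (x # w)) = U.sweedler (\<lambda>a b. \<iota> x * a * b + a * (\<iota> x * b)) (word w)"
      by (simp add: U.sweedler_primitive_mult[OF primitive_\<iota> U.vector_space_axioms bilinear_mult])
    also have "\<dots> = U.sweedler (\<lambda>a b. scaleU 2 (\<iota> x * (a * b)) - f a b) (word w)"
    proof -
      have "scaleU 2 y = y + y" for y
        using U.scale_left_distrib[of 1 1 y] by simp
      then show ?thesis by (simp add: f_def algebra_simps)
    qed
    also have "\<dots> = scaleU 2 (\<iota> x * ?m) - U.sweedler f (word w)"
      unfolding U.sweedler_fun_diff
      by (subst U.sweedler_additive) (simp_all add: distrib_left U.scale_right_distrib)
    finally show ?thesis .
  qed
  then have "U.sweedler (*) (word (x # w)) - scaleU (2 ^ length (x # w)) (word (x # w))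
      = scaleU 2 (\<iota> x * (?m - scaleU (2 ^ ?n) (word w))) - U.sweedler f (word w)"
    by (simp add: right_diff_distrib U.scale_mult_right U.scale_right_diff_distrib)
  ultimately show ?case by simp
qed

text \<open>
  Multiplying out the comultiplication doubles a primitive element, but it multiplies words of
  length \<open>n\<close> by \<open>2 ^ n\<close> up to shorter words.
\<close>

lemma primitive_in_range_\<iota>:
  assumes two: "\<And>n. n \<ge> 2 \<Longrightarrow> (2 :: 'k) ^ n \<noteq> 2" and p: "U.primitive p"
  shows "p \<in> range \<iota>"
proof -
  \<comment> \<open>Comparing the factors 2 and \<open>2 ^ n\<close> shows that
    \<open>scaleU (2 - 2 ^ n) p\<close> lies one stage lower, and this scalar is invertible by
    \<open>two\<close>.\<close>
  have reduce: "p \<in> words_below n" if "p \<in> words_below (Suc n)" "n \<ge> 2" for n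
  proof -
    have "U.sweedler (*) p - scaleU (2 ^ n) p \<in> words_below n"
    proof (rule words_below_image[OF that(1), where h = "\<lambda>p. U.sweedler (*) p - scaleU (2 ^ n) p"])
      fix w :: "'g list"
      assume "length w < Suc n"
      then consider "length w = n" | "length w < n" by linarith
      then show "U.sweedler (*) (word w) - scaleU (2 ^ n) (word w) \<in> words_below n"
      proof cases
        case 1
        then show ?thesis using sweedler_mult_word[of w] by simp
      next
        case 2
        have "(U.sweedler (*) (word w) - scaleU (2 ^ length w) (word w))
            + scaleU (2 ^ length w - 2 ^ n) (word w) \<in> words_below n"
          using 2 sweedler_mult_word[of w] words_below_mono[of "length w" n] word_in_words_below[of w n]
          by (intro U.subspace_add U.subspace_scale subspace_words_below) auto
        then show ?thesis by (simp add: U.scale_left_diff_distrib)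
      qed
    qed (simp_all add: U.sweedler_add[OF U.vector_space_axioms bilinear_mult]
        U.sweedler_scale[OF U.vector_space_axioms bilinear_mult] subspace_words_below
        U.scale_right_distrib U.scale_right_diff_distrib U.scale_left_commute algebra_simps)
    moreover have "U.sweedler (*) p = scaleU 2 p"
      using U.sweedler_primitive[OF p U.vector_space_axioms bilinear_mult]
        U.scale_left_distrib[of 1 1 p] by simp
    ultimately have "scaleU (2 - 2 ^ n) p \<in> words_below n"
      by (simp add: U.scale_left_diff_distrib)
    from U.subspace_scale[OF subspace_words_below this, of "inverse (2 - 2 ^ n)"] show ?thesis using two[OF that(2)] by simp
  qed
  obtain n where "p \<in> words_below n" using words_below_cover by blast
  then have "p \<in> words_below (n + 2)" using words_below_mono[of n "n + 2"] by auto
  then have "p \<in> words_below 2"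
  proof (induction n)
    case (Suc n)
    then show ?case using reduce[of "n + 2"] by simp
  qed (simp add: numeral_2_eq_2)
  \<comment> \<open>Words of length at most one span the scalars together with the image of
    \<open>\<iota>\<close>; the counit then removes the scalar part.\<close>
  then have "p \<in> {u. \<exists>c x. u = scaleU c 1 + \<iota> x}"
  proof (rule words_below_image)
    show "U.subspace {u. \<exists>c x. u = scaleU c 1 + \<iota> x}"
    proof (rule U.subspaceI)
      have "0 = scaleU 0 1 + \<iota> 0"
        using \<iota>_scale[of 0 0] by simp
      then show "0 \<in> {u. \<exists>c x. u = scaleU c 1 + \<iota> x}" by blast
    next
      fix u v
      assume "u \<in> {u. \<exists>c x. u = scaleU c 1 + \<iota> x}" "v \<in> {u. \<exists>c x. u = scaleU c 1 + \<iota> x}"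
      then obtain c x c' x' where "u = scaleU c 1 + \<iota> x" "v = scaleU c' 1 + \<iota> x'" by blast
      then have "u + v = scaleU (c + c') 1 + \<iota> (x + x')"
        by (simp add: U.scale_left_distrib \<iota>_add)
      then show "u + v \<in> {u. \<exists>c x. u = scaleU c 1 + \<iota> x}" by blast
    next
      fix c u
      assume "u \<in> {u. \<exists>c x. u = scaleU c 1 + \<iota> x}"
      then obtain c' x where "u = scaleU c' 1 + \<iota> x" by blast
      then have "scaleU c u = scaleU (c * c') 1 + \<iota> (scale c x)"
        by (simp add: U.scale_right_distrib \<iota>_scale)
      then show "scaleU c u \<in> {u. \<exists>c x. u = scaleU c 1 + \<iota> x}" by blast
    qed
    fix w :: "'g list"
    assume "length w < 2"
    then consider "w = []" | x where "w = [x]" by (cases w; cases "tl w") auto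
    then show "word w \<in> {u. \<exists>c x. u = scaleU c 1 + \<iota> x}"
    proof cases
      case 1
      have "word w = scaleU 1 1 + \<iota> 0"
        using \<iota>_scale[of 0 0] by (simp add: 1)
      then show ?thesis by blast
    next
      case (2 x)
      have "word w = scaleU 0 1 + \<iota> x" by (simp add: 2)
      then show ?thesis by blast
    qed
  qed simp_all
  then obtain c x where c: "p = scaleU c 1 + \<iota> x" by blast
  have "\<epsilon> p = c"
    by (simp add: c U.counit_add U.counit_scale U.counit_one U.counit_primitive[OF primitive_\<iota>])
  then have "p = \<iota> x" using c U.counit_primitive[OF p] by simp
  then show ?thesis by blast
qed

end

subsection \<open>Rota-Baxter operators on Hopf algebras\<close>

context hopf_algebra
begin

text \<open>The Rota-Baxter identity reads \<open>B x * B y = B (descendent B x y)\<close>.\<close>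

definition descendent :: "('a \<Rightarrow> 'a) \<Rightarrow> 'a \<Rightarrow> 'a \<Rightarrow> 'a" where
  "descendent B x y = sweedler (\<lambda>u c. sweedler (\<lambda>a b. a * B b * y * S (B c)) u) x"

lemma rota_baxter_hopf_iff:
  "rota_baxter_hopf scale \<Delta> \<epsilon> S B \<longleftrightarrow>
    coalgebra_map scale \<Delta> \<epsilon> B \<and> (\<forall>x y. B x * B y = B (descendent B x y))"
  by (simp add: rota_baxter_hopf_def descendent_def sweedler_def)

context
  fixes B :: "'a \<Rightarrow> 'a"
  assumes B: "coalgebra_map scale \<Delta> \<epsilon> B"
begin

lemma B_add: "B (x + y) = B x + B y"
  and B_scale: "B (scale c x) = scale c (B x)"
  and counit_B: "\<epsilon> (B x) = \<epsilon> x"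
  using B by (simp_all add: coalgebra_map_def Vector_Spaces.linear_iff)

lemma bilinear_descendent_inner: "bilinear scale scale (\<lambda>a b. a * B b * y * S (B c))"
  by (rule bilinearI) (simp_all add: B_add B_scale distrib_left distrib_right scale_mult)

lemma bilinear_descendent:
  "bilinear scale scale (\<lambda>u c. sweedler (\<lambda>a b. a * B b * y * S (B c)) u)"
  by (rule bilinearI)
    (simp_all add: sweedler_add[OF vector_space_axioms bilinear_descendent_inner]
      sweedler_scale[OF vector_space_axioms bilinear_descendent_inner]
      B_add B_scale antipode_add antipode_scale distrib_left scale_mult
      sweedler_fun_add sweedler_fun_scale[OF vector_space_axioms])

lemma descendent_add: "descendent B (x + x') y = descendent B x y + descendent B x' y"
  and descendent_scale: "descendent B (scale c x) y = scale c (descendent B x y)"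
  unfolding descendent_def
  by (rule sweedler_add sweedler_scale, rule vector_space_axioms, rule bilinear_descendent)+

lemma descendent_one:
  assumes "B 1 = 1"
  shows "descendent B 1 y = y"
  unfolding descendent_def sweedler_one[OF vector_space_axioms bilinear_descendent]
    sweedler_one[OF vector_space_axioms bilinear_descendent_inner]
  by (simp add: assms antipode_one)

text \<open>As the image of a group-like element, \<open>B 1\<close> has the right inverse
  \<open>S (B 1)\<close>. Hence \<open>descendent B 1 1\<close> is 1, so \<open>B 1\<close> is an
  idempotent with a right inverse.\<close>

lemma B_one_eq_one:
  assumes "B 1 * B 1 = B (descendent B 1 1)"
  shows "B 1 = 1"
proof -
  have bilin: "bilinear scale scale (\<lambda>a b. a * S b)"
    by (rule bilinearI)
      (simp_all add: antipode_add antipode_scale distrib_left distrib_right scale_mult)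
  then have bilin': "bilinear scale scale (\<lambda>a b. B a * S (B b))"
    by (simp add: bilinear_def B_add B_scale)
  have "scale (\<epsilon> (B 1)) 1 = sweedler (\<lambda>a b. B a * S (B b)) 1"
    unfolding sweedler_coalgebra_map[OF B vector_space_axioms bilin, symmetric]
    by (simp add: sweedler_antipode)
  then have inv: "B 1 * S (B 1) = 1"
    by (simp add: sweedler_one[OF vector_space_axioms bilin'] counit_B counit_one)
  have "descendent B 1 1 = 1"
    unfolding descendent_def sweedler_one[OF vector_space_axioms bilinear_descendent]
      sweedler_one[OF vector_space_axioms bilinear_descendent_inner]
    by (simp add: inv)
  with assms have "B 1 * B 1 = B 1" by simp
  then have "B 1 * (B 1 * S (B 1)) = B 1 * S (B 1)" by (simp add: mult.assoc[symmetric])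
  then show ?thesis by (simp add: inv)
qed

lemma primitive_B:
  assumes "B 1 = 1" "primitive p"
  shows "primitive (B p)"
  unfolding primitive_iff
proof (intro allI impI)
  fix \<beta> :: "'a \<Rightarrow> 'a \<Rightarrow> 'k"
  assume \<beta>: "bilinear scale (*) \<beta>"
  then have "bilinear scale (*) (\<lambda>a b. \<beta> (B a) (B b))"
    by (simp add: bilinear_def B_add B_scale)
  from sweedler_primitive[OF assms(2) vector_space_mult this]
  show "sweedler \<beta> (B p) = \<beta> (B p) 1 + \<beta> 1 (B p)"
    by (simp add: sweedler_coalgebra_map[OF B vector_space_mult \<beta>] assms(1))
qed

text \<open>The iterated comultiplication has \<open>p\<close> in one of three places. The third
  place contributes \<open>- y * B p\<close>, because \<open>S\<close> negates the primitive element
  \<open>B p\<close>.\<close>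

lemma descendent_primitive:
  assumes "B 1 = 1" "primitive p"
  shows "descendent B p y = p * y + (B p * y - y * B p)"
  unfolding descendent_def sweedler_primitive[OF assms(2) vector_space_axioms bilinear_descendent]
    sweedler_primitive[OF assms(2) vector_space_axioms bilinear_descendent_inner]
    sweedler_one[OF vector_space_axioms bilinear_descendent_inner]
  by (simp add: assms(1) antipode_one antipode_primitive[OF primitive_B[OF assms]])

end

text \<open>\<open>L\<close> is a linear combination of multiplications by primitive elements and
  therefore a coderivation.\<close>

lemma sweedler_twisted:
  assumes p: "primitive p" and q: "primitive q" and s': "vector_space s'" and f: "bilinear scale s' f"
    and L: "\<And>u. L u = p * u + (q * u - u * q)"
  shows "sweedler f (L u) = sweedler (\<lambda>a b. f (L a) b + f a (L b)) u"
proof -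
  interpret T: Vector_Spaces.linear scale s' "sweedler f"
    by (rule linear_sweedler[OF s' f])
  have f_diff: "f (x - x') y = f x y - f x' y" "f x (y - y') = f x y - f x y'" for x x' y y'
    using bilinearD(1)[OF f, of "x - x'" x'] bilinearD(2)[OF f, of _ "y - y'" y']
    by (simp_all add: algebra_simps)
  have "sweedler f (L u) = sweedler (\<lambda>a b. f (p * a) b + f a (p * b)) u
      + (sweedler (\<lambda>a b. f (q * a) b + f a (q * b)) u - sweedler (\<lambda>a b. f (a * q) b + f a (b * q)) u)"
    by (simp only: L T.add T.diff sweedler_primitive_mult[OF p s' f] sweedler_primitive_mult[OF q s' f])
  also have "\<dots> = sweedler (\<lambda>a b. f (L a) b + f a (L b)) u"
    unfolding sweedler_fun_diff[symmetric] sweedler_fun_add[symmetric] L bilinearD[OF f] f_diff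
    by (simp add: algebra_simps)
  finally show ?thesis .
qed

text \<open>The coderivation \<open>L\<close> acts on the three Sweedler factors in turn. Under
  \<open>B\<close> it becomes a factor \<open>q\<close>: the middle term cancels the right
  multiplication of \<open>a\<close> by \<open>q\<close>, and under \<open>S\<close> the third
  supplies the right multiplication of the whole product, leaving \<open>L\<close> of the
  product.\<close>

lemma descendent_twisted:
  assumes B: "coalgebra_map scale \<Delta> \<epsilon> B" and p: "primitive p" and q: "primitive q"
    and L: "\<And>u. L u = p * u + (q * u - u * q)" and BL: "\<And>u. B (L u) = q * B u"
  shows "descendent B (L h) y = L (descendent B h y)"
proof -
  have L_add: "L (x + y) = L x + L y" for x y
    by (simp add: L algebra_simps)
  let ?t = "\<lambda>a b c. a * B b * y * S (B c)"
  have "descendent B (L h) y = sweedler (\<lambda>u c. sweedler (\<lambda>a b. ?t a b c) (L u)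
      + sweedler (\<lambda>a b. ?t a b (L c)) u) h"
    unfolding descendent_def
    by (rule sweedler_twisted[OF p q vector_space_axioms bilinear_descendent[OF B] L])
  also have "\<dots> = sweedler (\<lambda>u c. sweedler (\<lambda>a b. ?t (L a) b c + ?t a (L b) c + ?t a b (L c)) u) h"
    by (simp only: sweedler_twisted[OF p q vector_space_axioms bilinear_descendent_inner[OF B] L]
        sweedler_fun_add)
  also have "\<dots> = sweedler (\<lambda>u c. sweedler (\<lambda>a b. L (?t a b c)) u) h"
    unfolding BL antipode_primitive_mult[OF q] unfolding L by (simp add: algebra_simps)
  also have "\<dots> = L (descendent B h y)"
    unfolding descendent_def by (simp only: sweedler_additive[of L, OF L_add])
  finally show ?thesis .
qed

end

subsection \<open>The operator on the enveloping algebra\<close>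

text \<open>The equation \<open>B (L\<^sub>x u) = R x * B u\<close> at a word \<open>u\<close>,
  solved for the value at \<open>x # u\<close>; \<open>ad_sum\<close> expands the commutator of
  \<open>R x\<close> with the word.\<close>

fun rb_word :: "('g \<Rightarrow> 'g \<Rightarrow> 'g) \<Rightarrow> ('g \<Rightarrow> 'g) \<Rightarrow> ('g \<Rightarrow> 'u::ring_1) \<Rightarrow> 'g list \<Rightarrow> 'u" where
  "rb_word br R \<iota> [] = 1"
| "rb_word br R \<iota> (x # w) = \<iota> (R x) * rb_word br R \<iota> w - ad_sum br (R x) (\<lambda>v. rb_word br R \<iota> v) w"

context universal_enveloping_algebra
begin

context
  fixes R :: "'g \<Rightarrow> 'g"
  assumes R: "rota_baxter_lie scale bracket R"
begin

abbreviation b :: "'g list \<Rightarrow> 'u" where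
  "b \<equiv> rb_word bracket R \<iota>"

lemma R_add: "R (x + y) = R x + R y"
  and R_scale: "R (scale c x) = scale c (R x)"
  and R_bracket: "bracket (R x) (R y) = R (bracket (R x) y + bracket x (R y) + bracket x y)"
  using R by (auto simp: rota_baxter_lie_def Vector_Spaces.linear_iff)

lemma multilinear_rb_word: "multilinear scale scaleU n b"
proof (induction n)
  case 0
  show ?case by (rule multilinear_0)
next
  case (Suc n)
  note lin = ad_sum_linear[OF U.vector_space_axioms, where f = b]
  show ?case
  proof (rule multilinear_SucI)
    fix a
    show "multilinear scale scaleU n (\<lambda>v. b (a # v))"
      using multilinearD[OF Suc] multilinearD[OF multilinear_ad_sum[OF U.vector_space_axioms Suc]]
      unfolding multilinear_def
      by (simp add: distrib_left U.scale_mult_right U.scale_right_diff_distrib algebra_simps)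
  qed (use Suc in \<open>simp_all add: R_add R_scale \<iota>_add \<iota>_scale lin distrib_right U.scale_mult_left
      U.scale_right_diff_distrib algebra_simps\<close>)
qed

lemma rb_word_add: "b (us @ (x + y) # vs) = b (us @ x # vs) + b (us @ y # vs)"
  using multilinearD[OF multilinear_rb_word refl] by blast

text \<open>Induction on the position of the swap. At the front, unfolding twice produces
  \<open>bracket (R x) (R y)\<close>, to which the Rota-Baxter identity applies. Further inside, the
  relation is preserved because \<open>ad (R a)\<close> is a derivation.\<close>

lemma rb_word_rel:
  "b (us @ x # y # vs) - b (us @ y # x # vs) = b (us @ bracket x y # vs)"
proof (induction "length us" arbitrary: us x y vs)
  case 0
  have ml: "multilinear scale scaleU (length vs) b" by (rule multilinear_rb_word)
  \<comment> \<open>Exchanging \<open>x\<close> and \<open>y\<close> exchanges the two mixed terms,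
    which thus cancel in the difference.\<close>
  have two: "b (x # y # vs) = \<iota> (R x) * \<iota> (R y) * b vs - \<iota> (R x) * ad_sum bracket (R y) b vs
      - b (bracket (R x) y # vs) - \<iota> (R y) * ad_sum bracket (R x) b vs
      + ad_sum bracket (R x) (ad_sum bracket (R y) b) vs" for x y
    by (simp add: ad_sum_diff ad_sum_additive[of "\<lambda>u. \<iota> z * u" for z] algebra_simps)
  have "b (x # y # vs) - b (y # x # vs) = \<iota> (bracket (R x) (R y)) * b vs
      - ad_sum bracket (bracket (R x) (R y)) b vs - b (bracket (R x) y # vs) + b (bracket (R y) x # vs)"
    unfolding two \<iota>_bracket ad_sum_bracket[OF ml, of "R y" "R x", symmetric]
    by (simp add: algebra_simps)
  \<comment> \<open>By the Rota-Baxter identity this is the recursion read backwards, with the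
    argument of \<open>R\<close> as first letter.\<close>
  also have "\<iota> (bracket (R x) (R y)) * b vs - ad_sum bracket (bracket (R x) (R y)) b vs
      = b ((bracket (R x) y + bracket x (R y) + bracket x y) # vs)"
    by (simp add: R_bracket)
  also have "\<dots> = b (bracket (R x) y # vs) + b (bracket x (R y) # vs) + b (bracket x y # vs)"
    using rb_word_add[of "[]"] by (simp del: rb_word.simps)
  also have "b (bracket x (R y) # vs) = - b (bracket (R y) x # vs)"
    using rb_word_add[of "[]" "- bracket (R y) x" "bracket (R y) x" vs] rb_word_add[of "[]" 0 0 vs]
    unfolding bracket_antisym[of x "R y"] by (simp add: eq_neg_iff_add_eq_0 del: rb_word.simps)
  finally show ?case using 0 by (simp del: rb_word.simps)
next
  case (Suc n)
  then obtain a us' where us: "us = a # us'" "n = length us'" by (cases us) auto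
  let ?A = "\<lambda>f. ad_sum bracket (R a) f"
  note IH = Suc.hyps(1)
  \<comment> \<open>The derivation hits the prefix, one of the two letters or the suffix. The swap
    now sits one place further left, so the induction hypothesis covers every kind of term.\<close>
  have A: "?A b (us' @ x # y # vs) = ?A (\<lambda>u. b (u @ x # y # vs)) us'
      + (b (us' @ bracket (R a) x # y # vs) + (b (us' @ x # bracket (R a) y # vs)
      + ?A (\<lambda>v. b (us' @ x # y # v)) vs))" for x y
    by (simp add: ad_sum_append)
  have A': "?A b (us' @ z # vs) = ?A (\<lambda>u. b (u @ z # vs)) us'
      + (b (us' @ bracket (R a) z # vs) + ?A (\<lambda>v. b (us' @ z # v)) vs)" for z
    by (simp add: ad_sum_append)
  have 1: "?A (\<lambda>u. b (u @ x # y # vs)) us' - ?A (\<lambda>u. b (u @ y # x # vs)) us'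
      = ?A (\<lambda>u. b (u @ bracket x y # vs)) us'"
    unfolding ad_sum_diff[symmetric] by (rule ad_sum_cong[OF refl refl refl], rule IH) (simp add: us)
  have 2: "?A (\<lambda>v. b (us' @ x # y # v)) vs - ?A (\<lambda>v. b (us' @ y # x # v)) vs
      = ?A (\<lambda>v. b (us' @ bracket x y # v)) vs"
    unfolding ad_sum_diff[symmetric] by (rule ad_sum_cong[OF refl refl refl], rule IH) (simp add: us)
  have 3: "b (us' @ bracket (R a) x # y # vs) - b (us' @ y # bracket (R a) x # vs)
      = b (us' @ bracket (bracket (R a) x) y # vs)"
    by (rule IH) (simp add: us)
  have 4: "b (us' @ x # bracket (R a) y # vs) - b (us' @ bracket (R a) y # x # vs)
      = b (us' @ bracket x (bracket (R a) y) # vs)"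
    by (rule IH) (simp add: us)
  have 5: "b (us' @ x # y # vs) - b (us' @ y # x # vs) = b (us' @ bracket x y # vs)"
    by (rule IH) (simp add: us)
  have 6: "b (us' @ bracket (R a) (bracket x y) # vs)
      = b (us' @ bracket (bracket (R a) x) y # vs) + b (us' @ bracket x (bracket (R a) y) # vs)"
    unfolding bracket_bracket[of "R a"] by (rule rb_word_add)
  have "?A b (us' @ x # y # vs) - ?A b (us' @ y # x # vs) = ?A b (us' @ bracket x y # vs)"
    unfolding A A' 6 1[symmetric] 2[symmetric] 3[symmetric] 4[symmetric] by (simp add: algebra_simps)
  then show ?case
    by (simp add: us 5[symmetric] right_diff_distrib algebra_simps)
qed

text \<open>The commutator is a derivation; the prefix \<open>s\<close> collects the letters already
  passed in the induction.\<close>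

lemma ad_sum_word:
  assumes "\<And>u v. F (u + v) = F u + F v"
  shows "ad_sum bracket z (\<lambda>v. F (s * word v)) w = F (s * (\<iota> z * word w - word w * \<iota> z))"
proof (induction w arbitrary: s)
  case Nil
  have "F 0 = 0" using assms[of 0 0] by simp
  then show ?case by simp
next
  case (Cons x w)
  have "ad_sum bracket z (\<lambda>v. F (s * word v)) (x # w) = F (s * (\<iota> (bracket z x) * word w))
      + F (s * \<iota> x * (\<iota> z * word w - word w * \<iota> z))"
    using Cons[of "s * \<iota> x"] by (simp add: mult.assoc)
  then show ?case by (simp add: assms[symmetric] \<iota>_bracket algebra_simps)
qed

lemma ex_twisted_map:
  "\<exists>B. Vector_Spaces.linear scaleU scaleU B \<and> B 1 = 1 \<and>
    (\<forall>x u. B (\<iota> x * u + (\<iota> (R x) * u - u * \<iota> (R x))) = \<iota> (R x) * B u)"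
proof -
  obtain B where B: "Vector_Spaces.linear scaleU scaleU B" and word: "\<And>w. B (word w) = b w"
    using linear_map_of_word_function[OF U.vector_space_axioms multilinear_rb_word rb_word_rel]
    by blast
  interpret B: Vector_Spaces.linear scaleU scaleU B by (rule B)
  have "B (\<iota> x * u + (\<iota> (R x) * u - u * \<iota> (R x))) = \<iota> (R x) * B u" for x u
  proof -
    \<comment> \<open>The difference of the two sides is linear in \<open>u\<close>, so it need only
      vanish on words.\<close>
    let ?h = "\<lambda>u. B (\<iota> x * u + (\<iota> (R x) * u - u * \<iota> (R x))) - \<iota> (R x) * B u"
    have "?h (word w) = 0" for w
    proof -
      have "b (x # w) = \<iota> (R x) * b w - B (1 * (\<iota> (R x) * word w - word w * \<iota> (R x)))"
        unfolding ad_sum_word[OF B.add, symmetric] by (simp add: word)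
      then show ?thesis using word[of "x # w"] by (simp add: B.add word)
    qed
    moreover have "?h (u + v) = ?h u + ?h v" "?h (scaleU c u) = scaleU c (?h u)" for u v c
      by (simp_all add: B.add B.diff B.scale algebra_simps U.scale_mult_left U.scale_mult_right
          U.scale_right_distrib U.scale_right_diff_distrib)
    ultimately have "?h u \<in> {0}"
      using words_below_cover[of u] words_below_image[of u _ ?h "{0}"] by auto
    then show ?thesis by simp
  qed
  moreover have "B 1 = 1" using word[of "[]"] by simp
  ultimately show ?thesis using B by blast
qed

end

end

section \<open>The Hopf operator obtained from a Lie operator\<close>

context enveloping_hopf_algebra
begin

lemma rota_baxter_hopf_twisted_map:
  assumes B: "Vector_Spaces.linear scaleU scaleU B" and one: "B 1 = 1"
    and step: "\<And>x u. B (\<iota> x * u + (\<iota> (R x) * u - u * \<iota> (R x))) = \<iota> (R x) * B u"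
  shows "rota_baxter_hopf scaleU \<Delta> \<epsilon> S B"
proof -
  interpret B: Vector_Spaces.linear scaleU scaleU B by (rule B)
  define L where "L x u = \<iota> x * u + (\<iota> (R x) * u - u * \<iota> (R x))" for x u
  have step: "B (L x u) = \<iota> (R x) * B u" for x u
    by (simp add: L_def step)
  note induct = twisted_induct[where R = R, folded L_def]
  note prim = primitive_\<iota>
  have counit: "\<epsilon> (B u) = \<epsilon> u" for u
  proof (induction u rule: induct)
    case (4 x u)
    have "\<epsilon> (B (L x u)) = 0"
      by (simp add: step U.counit_mult U.counit_primitive[OF prim])
    \<comment> \<open>Adding the subtracted product back leaves products with a primitive factor,
      which the counit kills.\<close>
    moreover have "\<epsilon> (L x u) + \<epsilon> (u * \<iota> (R x)) = 0"
      by (simp add: L_def U.counit_add[symmetric])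
        (simp add: U.counit_add U.counit_mult U.counit_primitive[OF prim])
    ultimately show ?case by (simp add: U.counit_mult U.counit_primitive[OF prim])
  qed (simp_all add: B.add B.scale U.counit_add U.counit_scale one)
  \<comment> \<open>The form is quantified inside the induction because the step uses the hypothesis
    for another form, \<open>\<gamma>\<close>.\<close>
  have comult: "\<forall>\<beta>. bilinear scaleU (*) \<beta> \<longrightarrow>
      U.sweedler \<beta> (B u) = U.sweedler (\<lambda>a b. \<beta> (B a) (B b)) u" for u
  proof (induction u rule: induct)
    case (1 u v)
    then show ?case
      by (simp add: B.add U.sweedler_add[OF vector_space_mult] bilinear_def B.scale)
  next
    case (2 c u)
    then show ?case
      by (simp add: B.scale U.sweedler_scale[OF vector_space_mult] bilinear_def B.add)
  next
    case 3
    then show ?case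
      by (simp add: one U.sweedler_one[OF vector_space_mult] bilinear_def B.add B.scale)
  next
    case (4 x u)
    show ?case
    proof (intro allI impI)
      fix \<beta> :: "'u \<Rightarrow> 'u \<Rightarrow> 'k"
      assume \<beta>: "bilinear scaleU (*) \<beta>"
      let ?q = "\<iota> (R x)"
      have \<beta>B: "bilinear scaleU (*) (\<lambda>a b. \<beta> (B a) (B b))"
        using \<beta> by (simp add: bilinear_def B.add B.scale)
      have \<gamma>: "bilinear scaleU (*) (\<lambda>a b. \<beta> (?q * a) b + \<beta> a (?q * b))"
        using \<beta> by (simp add: bilinear_def distrib_left U.scale_mult_right algebra_simps)
      have "U.sweedler \<beta> (B (L x u)) = U.sweedler (\<lambda>a b. \<beta> (?q * a) b + \<beta> a (?q * b)) (B u)"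
        unfolding step by (rule U.sweedler_primitive_mult(1)[OF prim vector_space_mult \<beta>])
      also have "\<dots> = U.sweedler (\<lambda>a b. \<beta> (?q * B a) (B b) + \<beta> (B a) (?q * B b)) u"
        using 4 \<gamma> by blast
      also have "\<dots> = U.sweedler (\<lambda>a b. \<beta> (B (L x a)) (B b) + \<beta> (B a) (B (L x b))) u"
        by (simp add: step)
      also have "\<dots> = U.sweedler (\<lambda>a b. \<beta> (B a) (B b)) (L x u)"
        by (rule U.sweedler_twisted[OF prim prim vector_space_mult \<beta>B L_def, symmetric])
      finally show "U.sweedler \<beta> (B (L x u)) = U.sweedler (\<lambda>a b. \<beta> (B a) (B b)) (L x u)" .
    qed
  qed
  have coalg: "coalgebra_map scaleU \<Delta> \<epsilon> B"
    unfolding U.coalgebra_map_iff using B comult counit by blast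
  \<comment> \<open>Passing from \<open>u\<close> to \<open>L x u\<close> multiplies both sides by
    \<open>\<iota> (R x)\<close>: on the right, \<open>L x\<close> is first moved out of
    \<open>descendent\<close> and then through \<open>B\<close>.\<close>
  have "\<forall>y. B u * B y = B (U.descendent B u y)" for u
  proof (induction u rule: induct)
    case (4 x u)
    show ?case
      using 4 by (simp add: U.descendent_twisted[OF coalg prim prim L_def step] step mult.assoc)
  qed (simp_all add: B.add B.scale U.descendent_add[OF coalg] U.descendent_scale[OF coalg]
      distrib_right U.scale_mult_left one U.descendent_one[OF coalg one])
  then show ?thesis unfolding U.rota_baxter_hopf_iff using coalg by blast
qed

section \<open>Restriction of a Hopf operator to the Lie algebra\<close>

context
  fixes B :: "'u \<Rightarrow> 'u"
  assumes RB: "rota_baxter_hopf scaleU \<Delta> \<epsilon> S B"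
begin

lemma coalgebra_map_B: "coalgebra_map scaleU \<Delta> \<epsilon> B"
  and rota_baxter_B: "B x * B y = B (U.descendent B x y)"
  using RB by (simp_all add: U.rota_baxter_hopf_iff)

lemma B_one: "B 1 = 1"
  by (rule U.B_one_eq_one[OF coalgebra_map_B]) (rule rota_baxter_B)

lemma B_twisted: "B (\<iota> x * u + (B (\<iota> x) * u - u * B (\<iota> x))) = B (\<iota> x) * B u"
  using rota_baxter_B[of "\<iota> x" u]
  by (simp add: U.descendent_primitive[OF coalgebra_map_B B_one primitive_\<iota>])

lemma primitive_B_\<iota>: "U.primitive (B (\<iota> x))"
  by (rule U.primitive_B[OF coalgebra_map_B B_one primitive_\<iota>])

lemma rota_baxter_lie_restriction:
  assumes R: "\<And>x. \<iota> (R x) = B (\<iota> x)"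
  shows "rota_baxter_lie scale bracket R"
proof -
  note B_lin = U.B_add[OF coalgebra_map_B] U.B_scale[OF coalgebra_map_B]
  have "R (x + y) = R x + R y" "R (scale c x) = scale c (R x)" for x y c
    by (rule injD[OF inj_\<iota>], simp add: R \<iota>_add \<iota>_scale B_lin)+
  moreover have "bracket (R x) (R y) = R (bracket (R x) y + bracket x (R y) + bracket x y)" for x y
  proof (rule injD[OF inj_\<iota>])
    interpret B: Vector_Spaces.linear scaleU scaleU B
      using coalgebra_map_B by (simp add: coalgebra_map_def)
    have "\<iota> (bracket (R x) (R y)) = B (\<iota> x) * B (\<iota> y) - B (\<iota> y) * B (\<iota> x)"
      by (simp add: \<iota>_bracket R)
    \<comment> \<open>Subtracting the two instances of \<open>B_twisted\<close> leaves
      \<open>B\<close> of exactly the three brackets of the Lie identity.\<close>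
    also have "\<dots> = B ((\<iota> x * \<iota> y + (B (\<iota> x) * \<iota> y - \<iota> y * B (\<iota> x)))
        - (\<iota> y * \<iota> x + (B (\<iota> y) * \<iota> x - \<iota> x * B (\<iota> y))))"
      by (simp only: B_twisted B.diff)
    also have "\<dots> = \<iota> (R (bracket (R x) y + bracket x (R y) + bracket x y))"
      by (simp add: R \<iota>_add \<iota>_bracket algebra_simps)
    finally show "\<iota> (bracket (R x) (R y)) = \<iota> (R (bracket (R x) y + bracket x (R y) + bracket x y))" .
  qed
  ultimately show ?thesis
    using vector_space_axioms by (simp add: rota_baxter_lie_def Vector_Spaces.linear_iff)
qed

end

text \<open>Both operators send 1 to 1 and satisfy the same twisted recursion, which determines them
  along \<open>twisted_induct\<close>.\<close>

lemma rota_baxter_hopf_eqI: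
  assumes B: "rota_baxter_hopf scaleU \<Delta> \<epsilon> S B" and B': "rota_baxter_hopf scaleU \<Delta> \<epsilon> S B'"
    and R: "\<And>x. \<iota> (R x) = B (\<iota> x)" "\<And>x. \<iota> (R x) = B' (\<iota> x)"
  shows "B = B'"
proof
  fix u
  note lin = U.B_add[OF coalgebra_map_B] U.B_scale[OF coalgebra_map_B]
  show "B u = B' u"
  proof (induction u rule: twisted_induct[where R = R])
    case (4 x u)
    then show ?case
      using B_twisted[OF B, of x u] B_twisted[OF B', of x u] by (simp add: R[symmetric])
  qed (simp_all add: lin[OF B] lin[OF B'] B_one[OF B] B_one[OF B'])
qed

text \<open>\<open>inv \<iota>\<close> makes sense here because \<open>B (\<iota> x)\<close> is
  primitive and hence in the range of \<open>\<iota>\<close>. Characteristic 0 enters in the form of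
  \<open>two\<close>.\<close>

lemma rota_baxter_bij:
  assumes two: "\<And>n. n \<ge> 2 \<Longrightarrow> (2 :: 'k) ^ n \<noteq> 2"
  defines "\<Phi> \<equiv> \<lambda>B x. inv \<iota> (B (\<iota> x))"
  shows "bij_betw \<Phi> {B. rota_baxter_hopf scaleU \<Delta> \<epsilon> S B} {R. rota_baxter_lie scale bracket R}"
    and "rota_baxter_hopf scaleU \<Delta> \<epsilon> S B \<Longrightarrow> B (\<iota> x) = \<iota> (\<Phi> B x)"
proof -
  have \<Phi>: "\<iota> (\<Phi> B x) = B (\<iota> x)" if "rota_baxter_hopf scaleU \<Delta> \<epsilon> S B" for B x
    unfolding \<Phi>_def
    by (rule f_inv_into_f) (rule primitive_in_range_\<iota>[OF two primitive_B_\<iota>[OF that]])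
  show "B (\<iota> x) = \<iota> (\<Phi> B x)" if "rota_baxter_hopf scaleU \<Delta> \<epsilon> S B"
    using \<Phi>[OF that] by simp
  show "bij_betw \<Phi> {B. rota_baxter_hopf scaleU \<Delta> \<epsilon> S B} {R. rota_baxter_lie scale bracket R}"
    unfolding bij_betw_def
  proof (intro conjI inj_onI subset_antisym subsetI; clarsimp)
    fix B B'
    assume B: "rota_baxter_hopf scaleU \<Delta> \<epsilon> S B" "rota_baxter_hopf scaleU \<Delta> \<epsilon> S B'" and "\<Phi> B = \<Phi> B'"
    then show "B = B'"
      using \<Phi>[OF B(1)] \<Phi>[OF B(2)] by (intro rota_baxter_hopf_eqI[of B B' "\<Phi> B"]) auto
  next
    fix B
    assume "rota_baxter_hopf scaleU \<Delta> \<epsilon> S B"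
    then show "rota_baxter_lie scale bracket (\<Phi> B)"
      by (intro rota_baxter_lie_restriction[of B] \<Phi>)
  next
    fix R
    assume "rota_baxter_lie scale bracket R"
    then obtain B where B: "Vector_Spaces.linear scaleU scaleU B" "B 1 = 1"
        "\<And>x u. B (\<iota> x * u + (\<iota> (R x) * u - u * \<iota> (R x))) = \<iota> (R x) * B u"
      using ex_twisted_map by blast
    then have "rota_baxter_hopf scaleU \<Delta> \<epsilon> S B" by (rule rota_baxter_hopf_twisted_map)
    \<comment> \<open>At \<open>u = 1\<close> the commutator vanishes.\<close>
    moreover have "B (\<iota> x) = \<iota> (R x)" for x
      using B(3)[of x 1] B(2) by simp
    then have "\<Phi> B = R"
      by (simp add: \<Phi>_def inv_f_f[OF inj_\<iota>])
    ultimately show "R \<in> \<Phi> ` {B. rota_baxter_hopf scaleU \<Delta> \<epsilon> S B}" by blast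
  qed
qed

end

text \<open>The second conjunct identifies the bijection as restriction along
  \<open>\<iota>\<close>; without it only the cardinalities would be compared.\<close>

theorem theorem2:
  fixes scale :: "'k::field_char_0 \<Rightarrow> 'g::ab_group_add \<Rightarrow> 'g"
    and bracket :: "'g \<Rightarrow> 'g \<Rightarrow> 'g"
    and scaleU :: "'k \<Rightarrow> 'u::ring_1 \<Rightarrow> 'u"
    and \<iota> :: "'g \<Rightarrow> 'u"
    and \<Delta> :: "'u \<Rightarrow> ('u \<times> 'u) multiset"
    and \<epsilon> :: "'u \<Rightarrow> 'k"
    and S :: "'u \<Rightarrow> 'u"
  assumes "lie_algebra scale bracket"
    and "enveloping_hopf_algebra scale bracket scaleU \<iota> \<Delta> \<epsilon> S"
  shows "\<exists>\<Phi>.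
           bij_betw \<Phi> {B. rota_baxter_hopf scaleU \<Delta> \<epsilon> S B} {R. rota_baxter_lie scale bracket R} \<and>
           (\<forall>B. rota_baxter_hopf scaleU \<Delta> \<epsilon> S B \<longrightarrow> (\<forall>x. B (\<iota> x) = \<iota> (\<Phi> B x)))"
proof -
  interpret enveloping_hopf_algebra scale bracket scaleU \<iota> \<Delta> \<epsilon> S by fact
  \<comment> \<open>In characteristic 0 the natural numbers embed into the field, so the inequality
    is inherited from them.\<close>
  have "(2 :: 'k) ^ n \<noteq> 2" if "n \<ge> 2" for n
  proof -
    have "2 ^ 1 < (2 :: nat) ^ n" using that by (intro power_strict_increasing) auto
    then have "(of_nat (2 ^ n) :: 'k) \<noteq> of_nat 2" unfolding of_nat_eq_iff by simp
    then show ?thesis by simp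
  qed
  from rota_baxter_bij[OF this] show ?thesis by blast
qed

end
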